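(* Suppose $S\in Map[\ell,k]$ is an optimal assignment map. Then, for any $i\in\{1,\dots,k\}$ and $j\in\{1,\dots,\ell\}$ with $S(j)=i$, there exists $z\in\Psi_i\setminus\{y_j\}$ such that $$0<|\pi(y_j)-\pi(z)|\le 2CR_i+\min_{i^*\ne i}|\pi(x_{i^*})-\pi(y_j)|$$ and $\pi(z)$ is between $\pi(y_j)$ and $\pi(x_i)$, where $$C=\frac{\sqrt{m-1}}{2^{1-(m-1)(1-\alpha)}-1}+1,$$ $\Psi_i=\{y_{h}:S(h)=i\}\cup\{x_i\}$ and $$R_i=\max\big\{\|z-p-\pi(z)v\|:z\in\{y_{h}:S(h)=i\}\cup\{x_1,\dots,x_k\}\big\}.$$
   Context: $\alpha\in[0,1)$ is a parameter. $X\subset\mathbb{R}^m$ is compact and convex, $\|\cdot\|$ is the Euclidean norm, $\mathbf{x}=\{x_1,\dots,x_k\}\subset X$ is a finite set of $k$ points, $\mathbf{b}=\sum_{j=1}^\ell n_j\delta_{y_j}$ with $y_j\in X$, $n_j>0$, $\sum_j n_j=1$. Points $p,v\in\mathbb{R}^m$ with $\|v\|=1$ are fixed, and $\pi(z)=\langle z-p,v\rangle$ for $z\in\mathbb{R}^m$. For atomic measures $\mathbf{a},\mathbf{c}$ (finite sums of positively weighted Dirac masses) on $X$ of equal mass, a transport path from $\mathbf{a}$ to $\mathbf{c}$ is a weighted directed graph $G$ (without cycles) with finite vertex set $V(G)$ containing the atoms of $\mathbf{a}$ and $\mathbf{c}$, finite set $E(G)$ of directed edges which are line segments from $e^-$ to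 $e^+$, and weights $w:E(G)\to(0,\infty)$ such that for all $v'\in V(G)$, $\sum_{e^-=v'}w(e)=\sum_{e^+=v'}w(e)+\mathbf{a}(\{v'\})-\mathbf{c}(\{v'\})$. $\mathbf{M}_\alpha(G)=\sum_{e\in E(G)}w(e)^\alpha\,length(e)$ and $d_\alpha(\mathbf{a},\mathbf{c})$ is the minimum of $\mathbf{M}_\alpha(G)$ over all transport paths from $\mathbf{a}$ to $\mathbf{c}$ ($0$ for zero measures). $Map[\ell,k]$ is the set of functions $S:\{1,\dots,\ell\}\to\{1,\dots,k\}$. For such $S$, $\mathbf{a}_i=\big(\sum_{j\in S^{-1}(i)}n_j\big)\delta_{x_i}$, $\mathbf{b}_i=\sum_{j\in S^{-1}(i)}n_j\delta_{y_j}$, and $\mathbf{E}_\alpha(S;\mathbf{x},\mathbf{b})=\sum_{i=1}^kd_\alpha(\mathbf{a}_i,\mathbf{b}_i)$. $S$ is an optimal assignment map if it minimizes $\mathbf{E}_\alpha(\cdot\,;\mathbf{x},\mathbf{b})$ over $Map[\ell,k]$.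
   Formalization: Assumes (m-1)(1-α)<1 (at equality C is undefined; beyond it C<0 and the bound fails) and π(y_j)≠π(x_i) (otherwise no z with π(z) between them has |π(y_j)-π(z)|>0). For k=1 the minimum over the empty set is read as +∞. *)

theory Defs
  imports "HOL-Analysis.Analysis" "HOL-Library.Poly_Mapping"
begin

text \<open>
  A finite sum of weighted Dirac masses is represented by its finitely supported mass function:
  \<open>Poly_Mapping.single z r\<close> is \<open>r \<delta>\<^sub>z\<close>, \<open>lookup a z\<close> is \<open>a({z})\<close>, and \<open>keys a\<close> is the set of atoms.
\<close>

type_synonym 'a atomic = "'a \<Rightarrow>\<^sub>0 real"

text \<open>
  A directed segment is given by its ordered pair of endpoints \<open>(e\<^sup>-, e\<^sup>+)\<close>. Acyclicity of the edge
  relation excludes directed cycles, and in particular degenerate segments. Equality of the total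
  masses of \<open>a\<close> and \<open>c\<close> follows by summing the balance equation over \<open>V\<close>.
\<close>

definition transport_path ::
  "'a::euclidean_space atomic \<Rightarrow> 'a atomic \<Rightarrow> 'a set \<Rightarrow> ('a \<times> 'a) set \<Rightarrow> ('a \<times> 'a \<Rightarrow> real) \<Rightarrow> bool"
  where
  "transport_path a c V E w \<longleftrightarrow>
     finite V \<and> Poly_Mapping.keys a \<union> Poly_Mapping.keys c \<subseteq> V \<and>
     E \<subseteq> V \<times> V \<and> acyclic E \<and> (\<forall>e\<in>E. 0 < w e) \<and>
     (\<forall>u\<in>V. (\<Sum>e | e \<in> E \<and> fst e = u. w e) =
             (\<Sum>e | e \<in> E \<and> snd e = u. w e) + Poly_Mapping.lookup a u - Poly_Mapping.lookup c u)"

definition M_alpha :: "real \<Rightarrow> ('a::euclidean_space \<times> 'a) set \<Rightarrow> ('a \<times> 'a \<Rightarrow> real) \<Rightarrow> real" where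
  "M_alpha \<alpha> E w = (\<Sum>e\<in>E. w e powr \<alpha> * dist (fst e) (snd e))"

text \<open>
  For measures of equal mass and \<open>0 \<le> \<alpha> < 1\<close> this infimum is attained, so that it is the minimum;
  measures of different mass admit no transport path, and the value is then meaningless.
\<close>

definition d_alpha :: "real \<Rightarrow> 'a::euclidean_space atomic \<Rightarrow> 'a atomic \<Rightarrow> real" where
  "d_alpha \<alpha> a c = Inf {M_alpha \<alpha> E w | V E w. transport_path a c V E w}"

lemma M_alpha_nonneg: "0 \<le> M_alpha \<alpha> E w"
  unfolding M_alpha_def by (intro sum_nonneg) simp

lemma d_alpha_zero: "d_alpha \<alpha> 0 0 = 0"
  unfolding d_alpha_def
proof (rule cInf_eq_minimum)
  have "transport_path (0 :: 'a atomic) 0 {} {} (\<lambda>_. 1)"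
    by (simp add: transport_path_def acyclic_def)
  moreover have "M_alpha \<alpha> ({} :: ('a \<times> 'a) set) (\<lambda>_. 1) = 0"
    by (simp add: M_alpha_def)
  ultimately show "0 \<in> {M_alpha \<alpha> E w | V E w. transport_path (0 :: 'a atomic) 0 V E w}"
    by force
qed (auto simp: M_alpha_nonneg)

definition assign_maps :: "nat \<Rightarrow> nat \<Rightarrow> (nat \<Rightarrow> nat) set" where
  "assign_maps l k = {1..l} \<rightarrow>\<^sub>E {1..k}"

definition preim :: "nat \<Rightarrow> (nat \<Rightarrow> nat) \<Rightarrow> nat \<Rightarrow> nat set" where
  "preim l S i = {h \<in> {1..l}. S h = i}"

definition a_part :: "nat \<Rightarrow> (nat \<Rightarrow> 'a) \<Rightarrow> (nat \<Rightarrow> real) \<Rightarrow> (nat \<Rightarrow> nat) \<Rightarrow> nat \<Rightarrow> 'a atomic" where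
  "a_part l x n S i = Poly_Mapping.single (x i) (\<Sum>h\<in>preim l S i. n h)"

definition b_part :: "nat \<Rightarrow> (nat \<Rightarrow> 'a) \<Rightarrow> (nat \<Rightarrow> real) \<Rightarrow> (nat \<Rightarrow> nat) \<Rightarrow> nat \<Rightarrow> 'a atomic" where
  "b_part l y n S i = (\<Sum>h\<in>preim l S i. Poly_Mapping.single (y h) (n h))"

definition E_alpha :: "real \<Rightarrow> nat \<Rightarrow> nat \<Rightarrow> (nat \<Rightarrow> 'a::euclidean_space) \<Rightarrow> (nat \<Rightarrow> 'a) \<Rightarrow>
    (nat \<Rightarrow> real) \<Rightarrow> (nat \<Rightarrow> nat) \<Rightarrow> real" where
  "E_alpha \<alpha> k l x y n S = (\<Sum>i=1..k. d_alpha \<alpha> (a_part l x n S i) (b_part l y n S i))"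

definition optimal_assignment :: "real \<Rightarrow> nat \<Rightarrow> nat \<Rightarrow> (nat \<Rightarrow> 'a::euclidean_space) \<Rightarrow> (nat \<Rightarrow> 'a) \<Rightarrow>
    (nat \<Rightarrow> real) \<Rightarrow> (nat \<Rightarrow> nat) \<Rightarrow> bool" where
  "optimal_assignment \<alpha> k l x y n S \<longleftrightarrow>
     is_arg_min (E_alpha \<alpha> k l x y n) (\<lambda>T. T \<in> assign_maps l k) S"

definition axis_coord :: "'a::euclidean_space \<Rightarrow> 'a \<Rightarrow> 'a \<Rightarrow> real" where
  "axis_coord p v z = (z - p) \<bullet> v"

text \<open>
  The quotient is \<open>sqrt (m - 1)\<close> times the geometric series \<open>\<Sum>s\<ge>1. 2 powr (- s * (1 - (m - 1) * (1 - \<alpha>)))\<close>,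
  so it is meaningful only for \<open>(m - 1) * (1 - \<alpha>) < 1\<close>; beyond that the formula is undefined or negative.
\<close>

definition C_const :: "real \<Rightarrow> nat \<Rightarrow> real" where
  "C_const \<alpha> m = sqrt (real m - 1) / (2 powr (1 - (real m - 1) * (1 - \<alpha>)) - 1) + 1"

definition Psi :: "nat \<Rightarrow> (nat \<Rightarrow> 'a) \<Rightarrow> (nat \<Rightarrow> 'a) \<Rightarrow> (nat \<Rightarrow> nat) \<Rightarrow> nat \<Rightarrow> 'a set" where
  "Psi l x y S i = y ` preim l S i \<union> {x i}"

definition R_max :: "'a::euclidean_space \<Rightarrow> 'a \<Rightarrow> nat \<Rightarrow> nat \<Rightarrow> (nat \<Rightarrow> 'a) \<Rightarrow> (nat \<Rightarrow> 'a) \<Rightarrow>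
    (nat \<Rightarrow> nat) \<Rightarrow> nat \<Rightarrow> real" where
  "R_max p v k l x y S i =
     Max ((\<lambda>z. norm (z - p - axis_coord p v z *\<^sub>R v)) ` (y ` preim l S i \<union> x ` {1..k}))"

end

theory Submission
  imports Defs
begin

text \<open>
  Let \<open>\<pi>\<close> be the coordinate along the axis, \<open>t0 = \<pi>(y\<^sub>j) < \<pi>(x\<^sub>i)\<close>, and let \<open>t2\<close> be the next value of
  \<open>\<pi>\<close> on \<open>\<Psi>\<^sub>i\<close> above \<open>t0\<close>. If the slab \<open>t0 < \<pi> < t2\<close> is too thick, it pays to hand over to another
  point of \<open>x\<close> all atoms that an almost optimal tree from \<open>x\<^sub>i\<close> reaches through the level \<open>\<pi> = t0\<close>:
  with \<open>M\<close> their mass, the slab part of the tree costs \<open>M\<^sup>\<alpha>\<close> times its thickness, and the part below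
  is reconnected along the level \<open>t0\<close> by irrigating a cube of half-edge \<open>R\<close> dyadically from its centre.

  The difficulty is that branches may dip into the slab and return, sharing edges with the mass
  handed over. In dimension at least 3 the hypothesis on \<open>\<alpha>\<close> forces \<open>\<alpha> > 1/2\<close>, so that
  \<open>a powr (2 * \<alpha>) + b powr (2 * \<alpha>) \<le> (a + b) powr (2 * \<alpha>)\<close>, and by Cauchy-Schwarz a shared edge
  pays both for the projection of the returning branch to the level \<open>t2\<close> and for the descent through
  the slab. In dimension at most 2 the level \<open>t2\<close> is a line, the loss on shared edges is at most
  \<open>2 * R\<close> per unit of \<open>M\<^sup>\<alpha>\<close>, and so is the cost of the reconnection; their sum \<open>4 * R\<close> is within the
  budget \<open>2 * C * R\<close> since \<open>C \<ge> 2\<close> or \<open>R = 0\<close>.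
\<close>

section \<open>Powers with exponent at most one\<close>

lemma powr_subadd:
  fixes s t \<alpha> :: real
  assumes "0 \<le> \<alpha>" "\<alpha> \<le> 1" "0 \<le> s" "0 \<le> t"
  shows "(s + t) powr \<alpha> \<le> s powr \<alpha> + t powr \<alpha>"
proof (cases "s = 0 \<or> t = 0")
  case False
  then have pos: "s > 0" "t > 0" using assms by auto
  let ?u = "s / (s + t)" and ?v = "t / (s + t)"
  have uv: "0 < ?u" "?u \<le> 1" "0 < ?v" "?v \<le> 1" "?u + ?v = 1"
    using pos by (simp_all flip: add_divide_distrib)
  have "?u + ?v \<le> ?u powr \<alpha> + ?v powr \<alpha>"
    using uv assms powr_mono'[of \<alpha> 1 ?u] powr_mono'[of \<alpha> 1 ?v] by (intro add_mono) auto
  then have "1 * (s + t) powr \<alpha> \<le> (?u powr \<alpha> + ?v powr \<alpha>) * (s + t) powr \<alpha>"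
    using uv(5) by (intro mult_right_mono) auto
  also have "\<dots> = s powr \<alpha> + t powr \<alpha>"
    using pos by (simp add: powr_divide distrib_right)
  finally show ?thesis by simp
qed auto

lemma powr_superadd:
  fixes a b \<beta> :: real
  assumes "1 \<le> \<beta>" "0 \<le> a" "0 \<le> b"
  shows "a powr \<beta> + b powr \<beta> \<le> (a + b) powr \<beta>"
proof -
  have "(a powr \<beta> + b powr \<beta>) powr (1 / \<beta>) \<le> (a powr \<beta>) powr (1 / \<beta>) + (b powr \<beta>) powr (1 / \<beta>)"
    using assms by (intro powr_subadd) auto
  also have "\<dots> = a + b" using assms by (simp add: powr_powr)
  finally have "((a powr \<beta> + b powr \<beta>) powr (1 / \<beta>)) powr \<beta> \<le> (a + b) powr \<beta>"
    using assms by (intro powr_mono2) auto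
  then show ?thesis using assms by (simp add: powr_powr)
qed

lemma powr_tangent:
  fixes c z \<alpha> :: real
  assumes "0 \<le> \<alpha>" "\<alpha> \<le> 1" "0 < c" "0 \<le> z"
  shows "z powr \<alpha> \<le> c powr \<alpha> * (1 + \<alpha> * (z / c - 1))"
proof (cases "z = 0")
  case True then show ?thesis using assms by simp
next
  case False
  then have zc: "z / c > 0" using assms by auto
  have "(z / c) powr \<alpha> \<le> 1 + \<alpha> * (z / c - 1)"
    using convex_onD[OF exp_convex, of \<alpha> 0 "ln (z / c)"] assms zc
    by (simp add: powr_def algebra_simps)
  then have "c powr \<alpha> * (z / c) powr \<alpha> \<le> c powr \<alpha> * (1 + \<alpha> * (z / c - 1))"
    by (intro mult_left_mono) auto
  then show ?thesis using assms by (simp add: powr_divide)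
qed

lemma powr_concave:
  fixes s t \<alpha> l :: real
  assumes \<alpha>: "0 \<le> \<alpha>" "\<alpha> \<le> 1" and st: "0 \<le> s" "0 \<le> t" and l: "0 \<le> l" "l \<le> 1"
  shows "l * s powr \<alpha> + (1 - l) * t powr \<alpha> \<le> (l * s + (1 - l) * t) powr \<alpha>"
proof (cases "l * s + (1 - l) * t = 0")
  case True
  have "l * s = 0" "(1 - l) * t = 0" using True st l 
    by (smt (verit, best) mult_nonneg_nonneg)+
  then show ?thesis using True by auto
next
  case False
  define c where "c = l * s + (1 - l) * t"
  have c: "c > 0" unfolding c_def using False st l
    by (smt (verit, best) mult_nonneg_nonneg)
  have "l * s powr \<alpha> + (1 - l) * t powr \<alpha> \<le>
      l * (c powr \<alpha> * (1 + \<alpha> * (s / c - 1))) + (1 - l) * (c powr \<alpha> * (1 + \<alpha> * (t / c - 1)))"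
    using powr_tangent[OF \<alpha> c] st l by (intro add_mono mult_left_mono) auto
  also have "\<dots> = c powr \<alpha> * (1 + \<alpha> * ((l * s + (1 - l) * t) / c - 1))"
    using c by (simp add: field_simps)
  also have "\<dots> = c powr \<alpha>" using c by (simp add: c_def)
  finally show ?thesis by (simp add: c_def)
qed

lemma sum_powr_le:
  fixes m :: "'b \<Rightarrow> real"
  assumes \<alpha>: "0 \<le> \<alpha>" "\<alpha> \<le> 1" and I: "finite I" and m: "\<And>i. i \<in> I \<Longrightarrow> 0 \<le> m i"
  shows "(\<Sum>i\<in>I. m i powr \<alpha>) \<le> real (card I) powr (1 - \<alpha>) * (sum m I) powr \<alpha>"
proof (cases "sum m I = 0")
  case True
  then have "m i = 0" if "i \<in> I" for i using that I m by (simp add: sum_nonneg_eq_0_iff)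
  then show ?thesis using True by simp
next
  case False
  have M: "0 < sum m I" using False m by (simp add: sum_nonneg order_less_le)
  then have "I \<noteq> {}" by auto
  then have N: "0 < real (card I)" using I by (simp add: card_gt_0_iff)
  define c where "c = sum m I / real (card I)"
  have c: "0 < c" using M N by (simp add: c_def)
  have "(\<Sum>i\<in>I. m i powr \<alpha>) \<le> (\<Sum>i\<in>I. c powr \<alpha> * (1 + \<alpha> * (m i / c - 1)))"
    using powr_tangent[OF \<alpha> c] m by (intro sum_mono) auto
  also have "\<dots> = c powr \<alpha> * (real (card I) + \<alpha> * (sum m I / c - real (card I)))"
    by (simp add: sum_subtractf sum.distrib flip: sum_distrib_left sum_divide_distrib)
  also have "sum m I / c = real (card I)" using M N by (simp add: c_def)
  also have "c powr \<alpha> * (real (card I) + \<alpha> * (real (card I) - real (card I))) =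
      real (card I) powr (1 - \<alpha>) * (sum m I) powr \<alpha>"
    using M N by (simp add: c_def powr_divide powr_diff)
  finally show ?thesis .
qed

lemma cauchy_two:
  fixes a b x y m d :: real
  assumes "a\<^sup>2 + b\<^sup>2 \<le> m\<^sup>2" "x\<^sup>2 + y\<^sup>2 \<le> d\<^sup>2" "0 \<le> m" "0 \<le> d"
  shows "a * x + b * y \<le> m * d"
proof (rule power2_le_imp_le)
  have "(a * x + b * y)\<^sup>2 + (a * y - b * x)\<^sup>2 = (a\<^sup>2 + b\<^sup>2) * (x\<^sup>2 + y\<^sup>2)"
    by (simp add: power2_eq_square algebra_simps)
  also have "\<dots> \<le> m\<^sup>2 * d\<^sup>2" using assms by (intro mult_mono) auto
  finally show "(a * x + b * y)\<^sup>2 \<le> (m * d)\<^sup>2"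
    using zero_le_power2[of "a * y - b * x"] unfolding power_mult_distrib by linarith
qed (use assms in auto)

section \<open>Flows with cycles\<close>

definition net :: "('a \<times> 'a) set \<Rightarrow> ('a \<times> 'a \<Rightarrow> real) \<Rightarrow> 'a \<Rightarrow> real" where
  "net E w u = (\<Sum>e\<in>E. w e * (of_bool (fst e = u) - of_bool (snd e = u)))"

lemma net_superset:
  assumes "finite E'" "E \<subseteq> E'" "\<And>e. e \<notin> E \<Longrightarrow> w e = 0"
  shows "net E' w u = net E w u"
  unfolding net_def using assms by (intro sum.mono_neutral_right) auto

lemma net_add: "net E (\<lambda>e. w e + t * f e) u = net E w u + t * net E f u"
  unfolding net_def by (simp add: distrib_right sum.distrib sum_distrib_left mult.assoc)

lemma net_single: "finite E \<Longrightarrow> e \<in> E \<Longrightarrow>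
    net E (\<lambda>e'. of_bool (e' = e)) u = of_bool (u = fst e) - of_bool (u = snd e)"
  unfolding net_def by (subst sum.remove[of _ e]) (auto simp: intro!: sum.neutral)

lemma net_conv:
  assumes "finite E"
  shows "net E w u = (\<Sum>e | e \<in> E \<and> fst e = u. w e) - (\<Sum>e | e \<in> E \<and> snd e = u. w e)"
proof -
  have "w e * (of_bool (fst e = u) - of_bool (snd e = u)) =
      (if fst e = u then w e else 0) - (if snd e = u then w e else 0)" for e
    by simp
  then show ?thesis
    using assms unfolding net_def by (simp add: sum_subtractf sum.inter_filter)
qed

definition flow :: "'a atomic \<Rightarrow> 'a atomic \<Rightarrow> ('a \<times> 'a) set \<Rightarrow> ('a \<times> 'a \<Rightarrow> real) \<Rightarrow> bool" where
  "flow a c E w \<longleftrightarrow> finite E \<and> (\<forall>e. 0 \<le> w e) \<and> (\<forall>e. e \<notin> E \<longrightarrow> w e = 0) \<and>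
     (\<forall>u. net E w u = Poly_Mapping.lookup a u - Poly_Mapping.lookup c u)"

definition pos_flow :: "'a atomic \<Rightarrow> 'a atomic \<Rightarrow> ('a \<times> 'a) set \<Rightarrow> ('a \<times> 'a \<Rightarrow> real) \<Rightarrow> bool" where
  "pos_flow a c E w \<longleftrightarrow> flow a c E w \<and> (\<forall>e\<in>E. 0 < w e)"

lemma M_alpha_superset:
  assumes "finite E'" "E \<subseteq> E'" "\<And>e. e \<notin> E \<Longrightarrow> w e = 0"
  shows "M_alpha \<alpha> E' w = M_alpha \<alpha> E w"
  unfolding M_alpha_def using assms by (intro sum.mono_neutral_right) auto

lemma walk_flow:
  assumes "(u, v) \<in> E\<^sup>*" "finite E"
  shows "\<exists>f. (\<forall>e. 0 \<le> f e) \<and> (\<forall>e. e \<notin> E \<longrightarrow> f e = 0) \<and>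
             (\<forall>z. net E f z = of_bool (z = u) - of_bool (z = v))"
  using assms(1)
proof (induction rule: rtrancl_induct)
  case base
  show ?case by (rule exI[of _ "\<lambda>_. 0"]) (simp add: net_def)
next
  case (step b c)
  then obtain f where f: "\<forall>e. 0 \<le> f e" "\<forall>e. e \<notin> E \<longrightarrow> f e = 0"
    "\<forall>z. net E f z = of_bool (z = u) - of_bool (z = b)" by blast
  show ?case
    using f step(2) assms(2) net_single[OF assms(2) step(2)] net_add[of E f 1 "\<lambda>e'. of_bool (e' = (b, c))"]
    by (intro exI[of _ "\<lambda>e. f e + 1 * of_bool (e = (b, c))"]) auto
qed

lemma pos_flow_shift:
  fixes E :: "('a::euclidean_space \<times> 'a) set"
  assumes w: "pos_flow a c E w"
    and g: "\<And>e. e \<notin> E \<Longrightarrow> g e = 0" "\<And>u. net E g u = 0" and e0: "0 < g e0"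
  shows "\<exists>t>0. pos_flow a c {e. 0 < w e - t * g e} (\<lambda>e. w e - t * g e) \<and> (\<forall>e. 0 \<le> w e - t * g e) \<and>
           {e. 0 < w e - t * g e} \<subset> E \<and>
           (\<forall>\<alpha>. M_alpha \<alpha> {e. 0 < w e - t * g e} (\<lambda>e. w e - t * g e) = M_alpha \<alpha> E (\<lambda>e. w e - t * g e))"
proof -
  let ?P = "{e\<in>E. 0 < g e}"
  have fin: "finite E" and wpos: "\<And>e. e \<in> E \<Longrightarrow> 0 < w e" and w0: "\<And>e. e \<notin> E \<Longrightarrow> w e = 0"
    and netw: "\<And>u. net E w u = Poly_Mapping.lookup a u - Poly_Mapping.lookup c u"
    using w by (auto simp: pos_flow_def flow_def)
  have P: "finite ?P" "e0 \<in> ?P" using fin e0 g(1)[of e0] by auto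
  define t where "t = Min ((\<lambda>e. w e / g e) ` ?P)"
  have "t \<in> (\<lambda>e. w e / g e) ` ?P" unfolding t_def using P by (intro Min_in finite_imageI) blast+
  then obtain e1 where e1: "e1 \<in> E" "0 < g e1" "t = w e1 / g e1" by auto
  have t: "t > 0" using e1 wpos by simp
  have le: "t \<le> w e / g e" if "e \<in> ?P" for e unfolding t_def using P that by (intro Min_le) auto
  have nonneg: "0 \<le> w e - t * g e" for e
  proof (cases "e \<in> ?P")
    case True then show ?thesis using le[OF True] by (simp add: field_simps)
  next
    case False
    then have "t * g e \<le> 0" using t g(1)[of e] by (cases "e \<in> E") (auto simp: mult_nonneg_nonpos)
    then show ?thesis using w unfolding pos_flow_def flow_def by (smt (verit))
  qed
  let ?E = "{e. 0 < w e - t * g e}" and ?w = "\<lambda>e. w e - t * g e"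
  have sub: "?E \<subseteq> E" using w0 g(1) by force
  have "e1 \<notin> ?E" using e1 by simp
  then have psub: "?E \<subset> E" using sub e1(1) by blast
  have z: "?w e = 0" if "e \<notin> ?E" for e using that nonneg[of e] by simp
  have cost: "M_alpha \<alpha> ?E ?w = M_alpha \<alpha> E ?w" for \<alpha>
    by (rule M_alpha_superset[OF fin sub z, symmetric])
  have "net ?E ?w u = net E ?w u" for u
    by (rule net_superset[OF fin sub z, symmetric])
  moreover have "net E ?w u = net E w u" for u
    using net_add[of E w "-t" g u] g(2)[of u] by simp
  ultimately have "pos_flow a c ?E ?w"
    unfolding pos_flow_def flow_def using netw nonneg z finite_subset[OF sub fin] by auto
  then show ?thesis using t psub nonneg cost by blast
qed

lemma pos_flow_support:
  assumes "flow a c E w"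
  shows "pos_flow a c {e. 0 < w e} w" "M_alpha \<alpha> {e. 0 < w e} w = M_alpha \<alpha> E w"
proof -
  have fin: "finite E" and nonneg: "\<And>e. 0 \<le> w e" and w0: "\<And>e. e \<notin> E \<Longrightarrow> w e = 0"
    and netw: "\<And>u. net E w u = Poly_Mapping.lookup a u - Poly_Mapping.lookup c u"
    using assms unfolding flow_def by blast+
  have sub: "{e. 0 < w e} \<subseteq> E"
  proof
    fix e assume "e \<in> {e. 0 < w e}"
    then show "e \<in> E" using w0[of e] by (cases "e \<in> E") auto
  qed
  have z: "w e = 0" if "e \<notin> {e. 0 < w e}" for e using that nonneg[of e] by simp
  have "net {e. 0 < w e} w u = Poly_Mapping.lookup a u - Poly_Mapping.lookup c u" for u
    unfolding netw[of u, symmetric] by (rule net_superset[OF fin sub z, symmetric])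
  then show "pos_flow a c {e. 0 < w e} w"
    unfolding pos_flow_def flow_def using nonneg z finite_subset[OF sub fin] by blast
  show "M_alpha \<alpha> {e. 0 < w e} w = M_alpha \<alpha> E w"
    by (rule M_alpha_superset[OF fin sub z, symmetric])
qed

lemma acyclic_reduction:
  assumes "0 \<le> \<alpha>" "pos_flow a c E w"
  shows "\<exists>E' w'. pos_flow a c E' w' \<and> acyclic E' \<and> M_alpha \<alpha> E' w' \<le> M_alpha \<alpha> E w"
  using assms(2)
proof (induction "card E" arbitrary: E w rule: less_induct)
  case less
  show ?case
  proof (cases "acyclic E")
    case True then show ?thesis using less.prems by blast
  next
    case False
    have fin: "finite E" using less.prems by (simp add: pos_flow_def flow_def)
    obtain u where "(u, u) \<in> E\<^sup>+" using False by (auto simp: acyclic_def)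
    then obtain v where v: "(u, v) \<in> E" "(v, u) \<in> E\<^sup>*" by (meson tranclD)
    obtain f where f: "\<forall>e. 0 \<le> f e" "\<forall>e. e \<notin> E \<longrightarrow> f e = 0"
      "\<forall>z. net E f z = of_bool (z = v) - of_bool (z = u)" using walk_flow[OF v(2) fin] by blast
    define g where "g = (\<lambda>e. f e + 1 * of_bool (e = (u, v)))"
    have g_nonneg: "0 \<le> g e" for e using f(1) by (simp add: g_def del: split_paired_All)
    have "\<And>e. e \<notin> E \<Longrightarrow> g e = 0" using f v by (auto simp: g_def)
    moreover have "net E g z = 0" for z
      unfolding g_def net_add using net_single[OF fin v(1)] f(3) by simp
    moreover have "0 < g (u, v)" using f(1) by (simp add: g_def add_nonneg_pos)
    ultimately obtain t where t: "t > 0"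
      "pos_flow a c {e. 0 < w e - t * g e} (\<lambda>e. w e - t * g e)" "\<forall>e. 0 \<le> w e - t * g e"
      "{e. 0 < w e - t * g e} \<subset> E"
      "\<forall>\<alpha>. M_alpha \<alpha> {e. 0 < w e - t * g e} (\<lambda>e. w e - t * g e) = M_alpha \<alpha> E (\<lambda>e. w e - t * g e)"
      using pos_flow_shift[OF less.prems] by blast
    have "M_alpha \<alpha> E (\<lambda>e. w e - t * g e) \<le> M_alpha \<alpha> E w"
      unfolding M_alpha_def using t(1,3) g_nonneg assms(1)
      by (intro sum_mono mult_right_mono powr_mono2) auto
    then have "M_alpha \<alpha> {e. 0 < w e - t * g e} (\<lambda>e. w e - t * g e) \<le> M_alpha \<alpha> E w"
      using t(5) by metis
    then show ?thesis
      using less.hyps[OF psubset_card_mono[OF fin t(4)] t(2)] by (meson order_trans)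
  qed
qed

lemma acyclic_flow_transport_path:
  assumes "pos_flow a c E w" "acyclic E"
  shows "\<exists>V. transport_path a c V E w"
proof (rule exI)
  let ?V = "Poly_Mapping.keys a \<union> Poly_Mapping.keys c \<union> fst ` E \<union> snd ` E"
  have fin: "finite E" using assms by (simp add: pos_flow_def flow_def)
  have "E \<subseteq> ?V \<times> ?V"
  proof
    fix e assume "e \<in> E"
    then show "e \<in> ?V \<times> ?V" by (metis UnI1 UnI2 image_eqI mem_Times_iff)
  qed
  then show "transport_path a c ?V E w"
    unfolding transport_path_def using assms fin
    by (auto simp: pos_flow_def flow_def net_conv[OF fin] algebra_simps)
qed

lemma transport_path_flow:
  assumes "transport_path a c V E w"
  shows "pos_flow a c E (\<lambda>e. if e \<in> E then w e else 0)" (is "pos_flow a c E ?w")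
    "M_alpha \<alpha> E (\<lambda>e. if e \<in> E then w e else 0) = M_alpha \<alpha> E w"
proof -
  have V: "finite V" "E \<subseteq> V \<times> V" "Poly_Mapping.keys a \<union> Poly_Mapping.keys c \<subseteq> V"
    using assms by (auto simp: transport_path_def)
  then have fin: "finite E" using finite_subset by blast
  have "net E ?w u = Poly_Mapping.lookup a u - Poly_Mapping.lookup c u" for u
  proof (cases "u \<in> V")
    case True
    have "(\<Sum>e | e \<in> E \<and> fst e = u. w e) =
             (\<Sum>e | e \<in> E \<and> snd e = u. w e) + Poly_Mapping.lookup a u - Poly_Mapping.lookup c u"
      using assms True by (simp add: transport_path_def)
    then show ?thesis by (simp add: net_conv[OF fin] cong: conj_cong)
  next
    case False
    then have "net E ?w u = 0" unfolding net_def using V by (intro sum.neutral) auto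
    moreover have "Poly_Mapping.lookup a u = 0" "Poly_Mapping.lookup c u = 0"
      using False V(3) by (auto simp: in_keys_iff)
    ultimately show ?thesis by simp
  qed
  then show "pos_flow a c E ?w"
    using assms fin by (auto simp: pos_flow_def flow_def transport_path_def less_imp_le)
  show "M_alpha \<alpha> E ?w = M_alpha \<alpha> E w" by (simp add: M_alpha_def)
qed

text \<open>Cycles are allowed here, so that superposing two flows needs no acyclicity argument.\<close>

definition carries :: "real \<Rightarrow> 'a::euclidean_space atomic \<Rightarrow> 'a atomic \<Rightarrow> real \<Rightarrow> bool" where
  "carries \<alpha> a c r \<longleftrightarrow> (\<exists>E w. flow a c E w \<and> M_alpha \<alpha> E w \<le> r)"

lemma carries_iff_transport_path:
  assumes "0 \<le> \<alpha>"
  shows "carries \<alpha> a c r \<longleftrightarrow> (\<exists>V E w. transport_path a c V E w \<and> M_alpha \<alpha> E w \<le> r)"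
proof
  assume "carries \<alpha> a c r"
  then obtain E w where w: "flow a c E w" "M_alpha \<alpha> E w \<le> r" unfolding carries_def by blast
  obtain E' w' where w': "pos_flow a c E' w'" "acyclic E'" "M_alpha \<alpha> E' w' \<le> M_alpha \<alpha> {e. 0 < w e} w"
    using acyclic_reduction[OF assms pos_flow_support(1)[OF w(1)]] by blast
  have "M_alpha \<alpha> E' w' \<le> r" using w'(3) w(2) unfolding pos_flow_support(2)[OF w(1)] by linarith
  then show "\<exists>V E w. transport_path a c V E w \<and> M_alpha \<alpha> E w \<le> r"
    using acyclic_flow_transport_path[OF w'(1,2)] by blast
next
  assume "\<exists>V E w. transport_path a c V E w \<and> M_alpha \<alpha> E w \<le> r"
  then obtain V E w where w: "transport_path a c V E w" "M_alpha \<alpha> E w \<le> r" by blast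
  then show "carries \<alpha> a c r"
    using transport_path_flow[OF w(1)] unfolding carries_def pos_flow_def by metis
qed

lemma carries_d_alpha_le:
  assumes "0 \<le> \<alpha>" "carries \<alpha> a c r"
  shows "d_alpha \<alpha> a c \<le> r"
proof -
  obtain V E w where "transport_path a c V E w" "M_alpha \<alpha> E w \<le> r"
    using assms carries_iff_transport_path by blast
  moreover have "bdd_below {M_alpha \<alpha> E w | V E w. transport_path a c V E w}"
    using M_alpha_nonneg by (intro bdd_belowI[of _ 0]) blast
  ultimately have "d_alpha \<alpha> a c \<le> M_alpha \<alpha> E w"
    unfolding d_alpha_def by (intro cInf_lower) blast+
  then show ?thesis using \<open>M_alpha \<alpha> E w \<le> r\<close> by linarith
qed

lemma d_alpha_less_transport_path:
  assumes "0 \<le> \<alpha>" "carries \<alpha> a c r" "d_alpha \<alpha> a c < s"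
  shows "\<exists>V E w. transport_path a c V E w \<and> M_alpha \<alpha> E w < s"
proof -
  have "{M_alpha \<alpha> E w | V E w. transport_path a c V E w} \<noteq> {}"
    using assms(2) carries_iff_transport_path[OF assms(1)] by blast
  from cInf_lessD[OF this, folded d_alpha_def, OF assms(3)] show ?thesis by blast
qed

lemma carries_mono:
  assumes "carries \<alpha> a c r" "r \<le> s"
  shows "carries \<alpha> a c s"
proof -
  obtain E w where "flow a c E w" "M_alpha \<alpha> E w \<le> r" using assms(1) unfolding carries_def by blast
  moreover from this have "M_alpha \<alpha> E w \<le> s" using assms(2) by linarith
  ultimately show ?thesis unfolding carries_def by blast
qed

lemma carries_add:
  assumes \<alpha>: "0 \<le> \<alpha>" "\<alpha> \<le> 1" and "carries \<alpha> a c r" "carries \<alpha> a' c' r'"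
  shows "carries \<alpha> (a + a') (c + c') (r + r')"
proof -
  obtain E w E' w' where f: "flow a c E w" "M_alpha \<alpha> E w \<le> r" "flow a' c' E' w'" "M_alpha \<alpha> E' w' \<le> r'"
    using assms(3,4) unfolding carries_def by blast
  let ?E = "E \<union> E'" and ?w = "\<lambda>e. w e + 1 * w' e"
  have fin: "finite ?E" and z: "\<And>e. e \<notin> E \<Longrightarrow> w e = 0" "\<And>e. e \<notin> E' \<Longrightarrow> w' e = 0"
    and nonneg: "\<And>e. 0 \<le> w e" "\<And>e. 0 \<le> w' e"
    using f by (auto simp: flow_def)
  have "net ?E w u = net E w u" "net ?E w' u = net E' w' u" for u
    using fin z by (auto intro!: net_superset)
  then have flow: "flow (a + a') (c + c') ?E ?w"
    using f(1,3) unfolding flow_def net_add by (auto simp: lookup_add)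
  have "M_alpha \<alpha> ?E ?w \<le> M_alpha \<alpha> ?E w + M_alpha \<alpha> ?E w'"
    unfolding M_alpha_def sum.distrib[symmetric]
  proof (rule sum_mono)
    fix e
    have "?w e powr \<alpha> \<le> w e powr \<alpha> + w' e powr \<alpha>"
      using powr_subadd[OF \<alpha> nonneg, of e e] by simp
    then have "?w e powr \<alpha> * dist (fst e) (snd e) \<le> (w e powr \<alpha> + w' e powr \<alpha>) * dist (fst e) (snd e)"
      by (rule mult_right_mono) simp
    then show "?w e powr \<alpha> * dist (fst e) (snd e) \<le>
        w e powr \<alpha> * dist (fst e) (snd e) + w' e powr \<alpha> * dist (fst e) (snd e)"
      by (simp add: distrib_right)
  qed
  moreover have "M_alpha \<alpha> ?E w = M_alpha \<alpha> E w" "M_alpha \<alpha> ?E w' = M_alpha \<alpha> E' w'"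
    using M_alpha_superset[OF fin _ z(1)] M_alpha_superset[OF fin _ z(2)] by auto
  ultimately have "M_alpha \<alpha> ?E ?w \<le> r + r'" using f(2,4) by linarith
  then show ?thesis unfolding carries_def using flow by blast
qed

lemma flow_cong:
  assumes "flow a c E w"
    "\<And>u. Poly_Mapping.lookup a u - Poly_Mapping.lookup c u = Poly_Mapping.lookup a' u - Poly_Mapping.lookup c' u"
  shows "flow a' c' E w"
  using assms unfolding flow_def by metis

lemma carries_trans:
  assumes "0 \<le> \<alpha>" "\<alpha> \<le> 1" "carries \<alpha> a b r" "carries \<alpha> b c r'"
  shows "carries \<alpha> a c (r + r')"
proof -
  obtain E w where "flow (a + b) (b + c) E w" "M_alpha \<alpha> E w \<le> r + r'"
    using carries_add[OF assms] unfolding carries_def by blast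
  moreover have "flow a c E w" by (rule flow_cong[OF calculation(1)]) (simp add: lookup_add)
  ultimately show ?thesis unfolding carries_def by blast
qed

lemma carries_refl: 
  assumes "0 \<le> r"
  shows "carries \<alpha> a a r"
proof -
  have "flow a a {} (\<lambda>_. 0)" "M_alpha \<alpha> {} (\<lambda>_. 0) \<le> r"
    using assms by (simp_all add: flow_def net_def M_alpha_def)
  then show ?thesis unfolding carries_def by blast
qed

lemma carries_single:
  assumes "0 \<le> r"
  shows "carries \<alpha> (Poly_Mapping.single u r) (Poly_Mapping.single v r) (r powr \<alpha> * dist u v)"
proof -
  have "flow (Poly_Mapping.single u r) (Poly_Mapping.single v r) {(u, v)} (\<lambda>e. if e = (u, v) then r else 0)"
    using assms by (simp add: flow_def net_def lookup_single when_def)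
  moreover have "M_alpha \<alpha> {(u, v)} (\<lambda>e. if e = (u, v) then r else 0) \<le> r powr \<alpha> * dist u v"
    by (simp add: M_alpha_def)
  ultimately show ?thesis unfolding carries_def by blast
qed

section \<open>Irrigation trees\<close>

lemma source_reaches_edges:
  assumes fin: "finite E" and acyc: "acyclic E" and w: "\<And>e. e \<in> E \<Longrightarrow> 0 < w e"
    and net: "\<And>u. u \<noteq> x \<Longrightarrow> net E w u \<le> 0" and ab: "(a, b) \<in> E"
  shows "(x, a) \<in> E\<^sup>*"
proof -
  have "wf E" using fin acyc by (rule finite_acyclic_wf)
  then have "\<forall>b. (a, b) \<in> E \<longrightarrow> (x, a) \<in> E\<^sup>*"
  proof (induction a rule: wf_induct_rule)
    case (less a)
    show ?case
    proof (intro allI impI)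
      fix b assume ab: "(a, b) \<in> E"
      show "(x, a) \<in> E\<^sup>*"
      proof (cases "a = x")
        case False
        have "0 < (\<Sum>e | e \<in> E \<and> fst e = a. w e)"
          using fin ab w by (intro sum_pos) auto
        then have "0 < (\<Sum>e | e \<in> E \<and> snd e = a. w e)"
          using net[OF False] by (simp add: net_conv[OF fin])
        then obtain e where "e \<in> E" "snd e = a"
          by (metis (mono_tags, lifting) empty_Collect_eq less_irrefl sum.empty)
        then have "(fst e, a) \<in> E" by (metis prod.collapse)
        then show ?thesis using less by (meson rtrancl.rtrancl_into_rtrancl)
      qed simp
    qed
  qed
  then show ?thesis using ab by blast
qed

lemma net_uminus: "net E (\<lambda>e. - g e) u = - net E g u"
  unfolding net_def by (simp add: sum_negf)

text \<open>
  Shifting flow along the difference of two walks from the source to a vertex with two incoming edges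
  changes the cost concavely, hence the cost does not increase in one of the two directions, and
  pushing that way until an edge is emptied shrinks the support.
\<close>

lemma indegree_reduction:
  assumes \<alpha>: "0 \<le> \<alpha>" "\<alpha> \<le> 1" and c: "\<And>u. 0 \<le> Poly_Mapping.lookup c u"
    and "pos_flow (Poly_Mapping.single x m) c E w" "acyclic E"
  shows "\<exists>E' w'. pos_flow (Poly_Mapping.single x m) c E' w' \<and> acyclic E' \<and>
           (\<forall>u v v'. (v, u) \<in> E' \<and> (v', u) \<in> E' \<longrightarrow> v = v') \<and> M_alpha \<alpha> E' w' \<le> M_alpha \<alpha> E w"
  using assms(4,5)
proof (induction "card E" arbitrary: E w rule: less_induct)
  case less
  let ?a = "Poly_Mapping.single x m"
  have fin: "finite E" and wpos: "\<And>e. e \<in> E \<Longrightarrow> 0 < w e" and w0: "\<And>e. e \<notin> E \<Longrightarrow> w e = 0"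
    and netw: "\<And>u. net E w u = Poly_Mapping.lookup ?a u - Poly_Mapping.lookup c u"
    using less.prems(1) by (auto simp: pos_flow_def flow_def)
  show ?case
  proof (cases "\<forall>u v v'. (v, u) \<in> E \<and> (v', u) \<in> E \<longrightarrow> v = v'")
    case True then show ?thesis using less.prems by blast
  next
    case False
    then obtain u v v' where uv: "(v, u) \<in> E" "(v', u) \<in> E" "v \<noteq> v'" by blast
    have nonpos: "net E w z \<le> 0" if "z \<noteq> x" for z
      using netw[of z] c[of z] that by (simp add: lookup_single)
    have reach: "(x, a) \<in> E\<^sup>*" if "(a, b) \<in> E" for a b
      using source_reaches_edges[OF fin less.prems(2) wpos nonpos that] by blast
    let ?E0 = "{e\<in>E. snd e \<noteq> u}"
    have walk: "\<exists>f. (\<forall>e. 0 \<le> f e) \<and> (\<forall>e. e \<notin> ?E0 \<longrightarrow> f e = 0) \<and>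
             (\<forall>z. net E f z = of_bool (z = x) - of_bool (z = p))" if p: "(p, u) \<in> E" for p
    proof -
      have "(x, p) \<in> ?E0\<^sup>*" using reach[OF p]
      proof (induction rule: converse_rtrancl_induct)
        case (step b d)
        have "d \<noteq> u" using step(2) p less.prems(2) unfolding acyclic_def
          by (meson rtrancl_into_trancl1)
        then show ?case using step by (simp add: converse_rtrancl_into_rtrancl)
      qed simp
      then obtain f where f: "\<forall>e. 0 \<le> f e" "\<forall>e. e \<notin> ?E0 \<longrightarrow> f e = 0"
        "\<forall>z. net ?E0 f z = of_bool (z = x) - of_bool (z = p)" using walk_flow[of x p ?E0] fin by auto
      then show ?thesis using net_superset[OF fin, of ?E0 f] by (intro exI[of _ f]) auto
    qed
    obtain f where f: "\<forall>e. e \<notin> ?E0 \<longrightarrow> f e = 0"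
      "\<forall>z. net E f z = of_bool (z = x) - of_bool (z = v)" using walk[OF uv(1)] by blast
    obtain f' where f': "\<forall>e. e \<notin> ?E0 \<longrightarrow> f' e = 0"
      "\<forall>z. net E f' z = of_bool (z = x) - of_bool (z = v')" using walk[OF uv(2)] by blast
    define g where "g = (\<lambda>e. ((f e + 1 * of_bool (e = (v, u))) + (-1) * f' e) + (-1) * of_bool (e = (v', u)))"
    have g0: "g e = 0" if "e \<notin> E" for e
      using that f(1)[rule_format, of e] f'(1)[rule_format, of e] uv by (auto simp: g_def)
    have gnet: "net E g z = 0" for z
      unfolding g_def net_add using net_single[OF fin uv(1)] net_single[OF fin uv(2)] f(2) f'(2) by simp
    have gv: "0 < g (v, u)" "0 < - g (v', u)" using f f' uv(3) by (auto simp: g_def)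
    obtain t where t: "t > 0" "pos_flow ?a c {e. 0 < w e - t * g e} (\<lambda>e. w e - t * g e)"
      "\<forall>e. 0 \<le> w e - t * g e" "{e. 0 < w e - t * g e} \<subset> E"
      "\<forall>\<alpha>. M_alpha \<alpha> {e. 0 < w e - t * g e} (\<lambda>e. w e - t * g e) = M_alpha \<alpha> E (\<lambda>e. w e - t * g e)"
      using pos_flow_shift[OF less.prems(1) g0 gnet gv(1)] by blast
    obtain t' where t': "t' > 0" "pos_flow ?a c {e. 0 < w e - t' * - g e} (\<lambda>e. w e - t' * - g e)"
      "\<forall>e. 0 \<le> w e - t' * - g e" "{e. 0 < w e - t' * - g e} \<subset> E"
      "\<forall>\<alpha>. M_alpha \<alpha> {e. 0 < w e - t' * - g e} (\<lambda>e. w e - t' * - g e) = M_alpha \<alpha> E (\<lambda>e. w e - t' * - g e)"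
    proof -
      have "- g e = 0" if "e \<notin> E" for e using g0[OF that] by simp
      moreover have "net E (\<lambda>e. - g e) z = 0" for z using gnet[of z] by (simp add: net_uminus)
      ultimately show thesis
        using that pos_flow_shift[OF less.prems(1), of "\<lambda>e. - g e", OF _ _ gv(2)] by blast
    qed
    define l where "l = t' / (t + t')"
    have l: "0 \<le> l" "l \<le> 1" "l * t = (1 - l) * t'" using t(1) t'(1) by (auto simp: l_def field_simps)
    let ?w1 = "\<lambda>e. w e - t * g e" and ?w2 = "\<lambda>e. w e - t' * - g e"
    have comb: "l * ?w1 e + (1 - l) * ?w2 e = w e" for e
    proof -
      have "l * ?w1 e + (1 - l) * ?w2 e = w e - (l * t) * g e + ((1 - l) * t') * g e"
        by (simp add: algebra_simps)
      then show ?thesis using l(3) by simp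
    qed
    have "l * M_alpha \<alpha> E ?w1 + (1 - l) * M_alpha \<alpha> E ?w2 =
        (\<Sum>e\<in>E. (l * ?w1 e powr \<alpha> + (1 - l) * ?w2 e powr \<alpha>) * dist (fst e) (snd e))"
      unfolding M_alpha_def by (simp add: sum_distrib_left sum.distrib distrib_right mult.assoc)
    also have "\<dots> \<le> M_alpha \<alpha> E w"
      unfolding M_alpha_def
    proof (intro sum_mono mult_right_mono)
      fix e assume "e \<in> E"
      show "l * ?w1 e powr \<alpha> + (1 - l) * ?w2 e powr \<alpha> \<le> w e powr \<alpha>"
        using powr_concave[OF \<alpha> t(3)[rule_format, of e] t'(3)[rule_format, of e] l(1,2)] comb[of e]
        by simp
    qed simp
    finally have conv: "l * M_alpha \<alpha> E ?w1 + (1 - l) * M_alpha \<alpha> E ?w2 \<le> M_alpha \<alpha> E w" .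
    have "M_alpha \<alpha> E ?w1 \<le> M_alpha \<alpha> E w \<or> M_alpha \<alpha> E ?w2 \<le> M_alpha \<alpha> E w"
    proof (rule ccontr)
      assume "\<not> ?thesis"
      then have "M_alpha \<alpha> E w < M_alpha \<alpha> E ?w1" "M_alpha \<alpha> E w < M_alpha \<alpha> E ?w2" by auto
      then have "(1 - l) * M_alpha \<alpha> E w + l * M_alpha \<alpha> E w <
          (1 - l) * M_alpha \<alpha> E ?w2 + l * M_alpha \<alpha> E ?w1"
        using l t(1) t'(1) by (intro add_le_less_mono mult_left_mono mult_strict_left_mono) (auto simp: l_def)
      then show False using conv by (simp add: algebra_simps)
    qed
    moreover have "M_alpha \<alpha> {e. 0 < ?w1 e} ?w1 = M_alpha \<alpha> E ?w1" using t(5) by blast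
    moreover have "M_alpha \<alpha> {e. 0 < ?w2 e} ?w2 = M_alpha \<alpha> E ?w2" using t'(5) by blast
    moreover have "acyclic {e. 0 < ?w1 e}" "acyclic {e. 0 < ?w2 e}"
      using acyclic_subset[OF less.prems(2)] t(4) t'(4) by blast+
    ultimately consider
        "acyclic {e. 0 < ?w1 e}" "M_alpha \<alpha> {e. 0 < ?w1 e} ?w1 \<le> M_alpha \<alpha> E w"
      | "acyclic {e. 0 < ?w2 e}" "M_alpha \<alpha> {e. 0 < ?w2 e} ?w2 \<le> M_alpha \<alpha> E w"
      by metis
    then show ?thesis
    proof cases
      case 1
      then show ?thesis
        using less.hyps[OF psubset_card_mono[OF fin t(4)] t(2) 1(1)] order_trans[OF _ 1(2)] by blast
    next
      case 2
      then show ?thesis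
        using less.hyps[OF psubset_card_mono[OF fin t'(4)] t'(2) 2(1)] order_trans[OF _ 2(2)] by blast
    qed
  qed
qed

locale irrigation =
  fixes \<alpha> :: real and n :: "nat \<Rightarrow> real" and y :: "nat \<Rightarrow> 'a::euclidean_space"
  assumes alpha: "0 \<le> \<alpha>" "\<alpha> < 1" and n_pos: "\<And>h. 0 < n h"
begin

abbreviation mass :: "nat set \<Rightarrow> real" where "mass A \<equiv> sum n A"

definition masses :: "nat set \<Rightarrow> (nat \<Rightarrow> 'a) \<Rightarrow> 'a atomic" where
  "masses A z = (\<Sum>h\<in>A. Poly_Mapping.single (z h) (n h))"

definition moves :: "(nat \<Rightarrow> 'a) \<Rightarrow> (nat \<Rightarrow> 'a) \<Rightarrow> nat set \<Rightarrow> real \<Rightarrow> bool" where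
  "moves z z' A r \<longleftrightarrow> carries \<alpha> (masses A z) (masses A z') r"

lemma mass_nonneg [simp]: "0 \<le> mass A"
  using n_pos by (simp add: sum_nonneg less_imp_le)

lemma mass_mono: "finite A \<Longrightarrow> B \<subseteq> A \<Longrightarrow> mass B \<le> mass A"
  using n_pos by (intro sum_mono2) (auto simp: less_imp_le)

lemma mass_powr_mono: "finite A \<Longrightarrow> B \<subseteq> A \<Longrightarrow> mass B powr \<alpha> \<le> mass A powr \<alpha>"
  using alpha mass_mono by (intro powr_mono2) auto

lemma masses_cong: "(\<And>h. h \<in> A \<Longrightarrow> z h = z' h) \<Longrightarrow> masses A z = masses A z'"
  unfolding masses_def by (intro sum.cong) auto

lemma masses_const: "masses A (\<lambda>_. u) = Poly_Mapping.single u (mass A)"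
  unfolding masses_def by (induction A rule: infinite_finite_induct) (auto simp: single_add)

lemma masses_union: "finite A \<Longrightarrow> finite B \<Longrightarrow> A \<inter> B = {} \<Longrightarrow> masses (A \<union> B) z = masses A z + masses B z"
  unfolding masses_def by (rule sum.union_disjoint)

lemma lookup_masses: "finite A \<Longrightarrow> Poly_Mapping.lookup (masses A z) u = mass {h\<in>A. z h = u}"
  unfolding masses_def by (simp add: lookup_sum lookup_single when_def sum.inter_filter)

lemma moves_cong:
  "(\<And>h. h \<in> A \<Longrightarrow> z h = w h) \<Longrightarrow> (\<And>h. h \<in> A \<Longrightarrow> z' h = w' h) \<Longrightarrow> moves z z' A r \<longleftrightarrow> moves w w' A r"
  unfolding moves_def using masses_cong by metis

lemma moves_mono: "moves z z' A r \<Longrightarrow> r \<le> s \<Longrightarrow> moves z z' A s"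
  unfolding moves_def by (rule carries_mono)

lemma moves_refl: "(\<And>h. h \<in> A \<Longrightarrow> z h = z' h) \<Longrightarrow> 0 \<le> r \<Longrightarrow> moves z z' A r"
  unfolding moves_def using masses_cong carries_refl by metis

lemma moves_trans: "moves z z' A r \<Longrightarrow> moves z' z'' A s \<Longrightarrow> moves z z'' A (r + s)"
  unfolding moves_def using carries_trans alpha by (metis less_imp_le)

lemma moves_union:
  "finite A \<Longrightarrow> finite B \<Longrightarrow> A \<inter> B = {} \<Longrightarrow> moves z z' A r \<Longrightarrow> moves z z' B s \<Longrightarrow>
    moves z z' (A \<union> B) (r + s)"
  unfolding moves_def using carries_add alpha masses_union by (metis less_imp_le)

lemma moves_const: "moves (\<lambda>_. u) (\<lambda>_. v) A (mass A powr \<alpha> * dist u v)"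
  unfolding moves_def masses_const by (rule carries_single) simp

lemma moves_exists: "finite A \<Longrightarrow> \<exists>r. moves z z' A r"
proof (induction A rule: finite_induct)
  case empty
  show ?case using moves_refl[of "{}" z z' 0] by auto
next
  case (insert h A)
  then obtain r where "moves z z' A r" by blast
  moreover have "moves z z' {h} (mass {h} powr \<alpha> * dist (z h) (z' h))"
    using moves_const[of "z h" "z' h" "{h}"] by (subst moves_cong) auto
  ultimately have "moves z z' ({h} \<union> A) (mass {h} powr \<alpha> * dist (z h) (z' h) + r)"
    using insert by (intro moves_union) auto
  then show ?case by auto
qed

inductive tree :: "'a set \<Rightarrow> 'a \<Rightarrow> nat set \<Rightarrow> real \<Rightarrow> bool" for K where
  empty: "tree K u {} 0"
| own: "y h = u \<Longrightarrow> tree K u {h} 0"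
| join: "tree K u A r \<Longrightarrow> tree K u B s \<Longrightarrow> A \<inter> B = {} \<Longrightarrow> tree K u (A \<union> B) (r + s)"
| edge: "tree K v A r \<Longrightarrow> u \<in> K \<Longrightarrow> v \<in> K \<Longrightarrow> r + mass A powr \<alpha> * dist u v \<le> s \<Longrightarrow> tree K u A s"

lemma tree_finite: "tree K u A r \<Longrightarrow> finite A"
  by (induction rule: tree.induct) auto

lemma tree_nonneg: "tree K u A r \<Longrightarrow> 0 \<le> r"
proof (induction rule: tree.induct)
  case (edge v A r u s)
  have "0 \<le> mass A powr \<alpha> * dist u v" by simp
  then show ?case using edge by linarith
qed auto

lemma tree_moves: "tree K u A r \<Longrightarrow> moves (\<lambda>_. u) y A r"
proof (induction rule: tree.induct)
  case (empty u)
  show ?case by (rule moves_refl) auto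
next
  case (own h u)
  then show ?case by (intro moves_refl) auto
next
  case (join u A r B s)
  then show ?case using tree_finite by (intro moves_union) auto
next
  case (edge v A r u s)
  show ?case
    by (rule moves_mono[OF moves_trans[of "\<lambda>_. u", OF moves_const edge(5)]]) (use edge(4) in simp)
qed

lemma tree_retract:
  assumes "tree K u A r" "\<And>h. h \<in> A \<Longrightarrow> g (y h) = y h"
    and "\<And>z. g z \<in> K'" "\<And>z z'. dist (g z) (g z') \<le> dist z z'"
  shows "tree K' (g u) A r"
  using assms(1,2)
proof (induction rule: tree.induct)
  case (empty u)
  show ?case by (rule tree.empty)
next
  case (own h u)
  then show ?case by (intro tree.own) auto
next
  case (join u A r B s)
  then show ?case by (intro tree.join) auto
next
  case (edge v A r u s)
  have "mass A powr \<alpha> * dist (g u) (g v) \<le> mass A powr \<alpha> * dist u v"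
    using assms(4) by (intro mult_left_mono) auto
  then have "r + mass A powr \<alpha> * dist (g u) (g v) \<le> s" using edge.hyps(4) by linarith
  then show ?case using tree.edge[OF edge.IH[OF edge.prems] assms(3) assms(3)] by blast
qed

lemma forest_tree:
  assumes "finite V" "x \<in> V" "E \<subseteq> V \<times> V" "acyclic E" "\<And>e. e \<in> E \<Longrightarrow> 0 < w e"
    and "\<And>u v v'. (v, u) \<in> E \<Longrightarrow> (v', u) \<in> E \<Longrightarrow> v = v'"
    and "\<And>u. u \<in> V \<Longrightarrow> tree UNIV u (L u) (r u)"
    and "\<And>u v. u \<in> V \<Longrightarrow> v \<in> V \<Longrightarrow> u \<noteq> v \<Longrightarrow> L u \<inter> L v = {}"
    and "\<And>u. u \<in> V \<Longrightarrow> net E w u = (if u = x then mass (\<Union>(L ` V)) else 0) - mass (L u)"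
  shows "tree UNIV x (\<Union>(L ` V)) (sum r V + M_alpha \<alpha> E w)"
  using assms
proof (induction "card V" arbitrary: V E L r rule: less_induct)
  case less
  note V = less.prems(1-3) and E = less.prems(4-6) and L = less.prems(7,8) and net = less.prems(9)
  have fin: "finite E" using V finite_subset by blast
  show ?case
  proof (cases "V = {x}")
    case True
    have "E = {}"
    proof (rule ccontr)
      assume "E \<noteq> {}"
      then have "(x, x) \<in> E" using V True by auto
      then show False using E(1) by (auto simp: acyclic_def)
    qed
    then show ?thesis using L(1)[of x] True by (simp add: M_alpha_def)
  next
    case False
    have "wf (E\<inverse>)" using fin E(1) by (rule finite_acyclic_wf_converse)
    moreover have "V - {x} \<noteq> {}" using False V by auto
    ultimately obtain u where u: "u \<in> V - {x}" "\<And>v. (u, v) \<in> E \<Longrightarrow> v \<notin> V - {x}"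
      using wfE_min'[of "E\<inverse>" "V - {x}"] by (metis converse_iff)
    have nonpos: "net E w z \<le> 0" if "z \<noteq> x" for z
    proof (cases "z \<in> V")
      case True then show ?thesis using net[OF True] that by simp
    next
      case False
      then have "net E w z = 0" unfolding net_def using V(3) by (intro sum.neutral) auto
      then show ?thesis by simp
    qed
    have reach: "(x, a) \<in> E\<^sup>*" if "(a, b) \<in> E" for a b
      using source_reaches_edges[OF fin E(1,2) nonpos that] by blast
    have no_out: "(u, v) \<notin> E" for v
    proof
      assume uv: "(u, v) \<in> E"
      then have "v = x" using u(2)[OF uv] V by auto
      moreover have "(x, u) \<in> E\<^sup>*" using reach[OF uv] by simp
      ultimately show False using uv E(1) unfolding acyclic_def by (meson rtrancl_into_trancl1)
    qed
    have "(\<Sum>e | e \<in> E \<and> fst e = u. w e) = 0" using no_out by (intro sum.neutral) auto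
    then have inflow: "(\<Sum>e | e \<in> E \<and> snd e = u. w e) = mass (L u)"
      using net[of u] u(1) by (simp add: net_conv[OF fin])
    have card: "card (V - {u}) < card V" using V u by (intro psubset_card_mono) auto
    have finL: "finite (L z)" if "z \<in> V" for z using L(1)[OF that] by (rule tree_finite)
    have r0: "0 \<le> r u"
      using L(1)[of u] u tree_nonneg by blast
    show ?thesis
    proof (cases "L u = {}")
      case True
      have "\<not> (snd e = u)" if "e \<in> E" for e
      proof
        assume "snd e = u"
        then have "0 < (\<Sum>e | e \<in> E \<and> snd e = u. w e)" using fin that E(2)
          by (intro sum_pos2[of _ e]) (auto intro: less_imp_le)
        then show False using inflow True by simp
      qed
      then have EV: "E \<subseteq> (V - {u}) \<times> (V - {u})" using V(3) no_out by fastforce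
      have U: "\<Union>(L ` (V - {u})) = \<Union>(L ` V)" using True by auto
      have "net E w z = (if z = x then mass (\<Union>(L ` (V - {u}))) else 0) - mass (L z)"
        if "z \<in> V - {u}" for z
        unfolding U using net[of z] that by blast
      moreover have "finite (V - {u})" "x \<in> V - {u}" using V u by auto
      ultimately have "tree UNIV x (\<Union>(L ` (V - {u}))) (sum r (V - {u}) + M_alpha \<alpha> E w)"
        using less.hyps[OF card _ _ EV E(1,2) _ L(1) L(2)] E(3) by blast
      then have "tree UNIV x (\<Union>(L ` V)) (sum r (V - {u}) + M_alpha \<alpha> E w)" by (simp only: U)
      then show ?thesis by (rule tree.edge[where v = x]) (use V u r0 in \<open>auto simp: sum_diff1\<close>)
    next
      case False
      then have "0 < mass (L u)" using finL u n_pos by (intro sum_pos) auto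
      then have "\<exists>e. e \<in> E \<and> snd e = u" using inflow
        by (metis (mono_tags, lifting) empty_Collect_eq less_irrefl sum.empty)
      then obtain q where q: "(q, u) \<in> E" by (metis prod.collapse)
      have qu: "q \<noteq> u" "q \<in> V" using q no_out V by auto
      have "{e. e \<in> E \<and> snd e = u} = {(q, u)}" using q E(3) by auto
      then have wq: "w (q, u) = mass (L u)" using inflow by simp
      define E' where "E' = E - {(q, u)}"
      define L' where "L' = L(q := L q \<union> L u)"
      define r' where "r' = r(q := r q + (r u + mass (L u) powr \<alpha> * dist q u))"
      have U: "\<Union>(L' ` (V - {u})) = \<Union>(L ` V)" using qu u by (auto simp: L'_def split: if_splits)
      have net': "net E' w v = net E w v - mass (L u) * (of_bool (q = v) - of_bool (u = v))" for v
        unfolding net_def E'_def using fin q wq by (simp add: sum_diff1)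
      have EV: "E' \<subseteq> (V - {u}) \<times> (V - {u})"
        using V(3) no_out E(3)[OF _ q] unfolding E'_def by auto
      have mq: "mass (L q \<union> L u) = mass (L q) + mass (L u)"
        using finL qu u L(2) by (intro sum.union_disjoint) auto
      have qu_disj: "L q \<inter> L u = {}" using L(2) qu u by blast
      have acyc: "acyclic E'" using E(1) acyclic_subset[of E E'] by (auto simp: E'_def)
      have T: "tree UNIV z (L' z) (r' z)" if z: "z \<in> V - {u}" for z
      proof (cases "z = q")
        case True
        have "tree UNIV q (L u) (r u + mass (L u) powr \<alpha> * dist q u)"
          by (rule tree.edge[where v = u and r = "r u"]) (use L(1)[of u] u(1) in auto)
        then have "tree UNIV q (L q \<union> L u) (r q + (r u + mass (L u) powr \<alpha> * dist q u))"
          using tree.join[OF L(1)[OF qu(2)]] qu_disj by blast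
        then show ?thesis by (simp add: True L'_def r'_def)
      next
        case False then show ?thesis using z L(1)[of z] by (simp add: L'_def r'_def)
      qed
      have D: "L' z \<inter> L' z' = {}" if "z \<in> V - {u}" "z' \<in> V - {u}" "z \<noteq> z'" for z z'
      proof -
        have "L z \<inter> L z' = {}" "L u \<inter> L z' = {}" "L z \<inter> L u = {}"
          using L(2)[of z z'] L(2)[of u z'] L(2)[of z u] u that by auto
        then show ?thesis using that(3) by (auto simp: L'_def)
      qed
      have N: "net E' w z = (if z = x then mass (\<Union>(L' ` (V - {u}))) else 0) - mass (L' z)"
        if z: "z \<in> V - {u}" for z
        unfolding net' U using net[of z] z mq by (auto simp: L'_def)
      have "finite (V - {u})" "x \<in> V - {u}" using V u by auto
      moreover have "\<And>e. e \<in> E' \<Longrightarrow> 0 < w e" using E(2) by (simp add: E'_def)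
      moreover have "a = b" if "(a, d) \<in> E'" "(b, d) \<in> E'" for a b d
        using E(3)[of a d b] that by (simp add: E'_def)
      ultimately have "tree UNIV x (\<Union>(L' ` (V - {u}))) (sum r' (V - {u}) + M_alpha \<alpha> E' w)"
        using less.hyps[OF card _ _ EV acyc _ _ T D N] by blast
      moreover have "sum r' (V - {u}) + M_alpha \<alpha> E' w = sum r V + M_alpha \<alpha> E w"
      proof -
        have "sum r' (V - {u}) = r' q + sum r' (V - {u} - {q})"
          using V qu by (intro sum.remove) auto
        also have "sum r' (V - {u} - {q}) = sum r (V - {u} - {q})" by (auto simp: r'_def intro!: sum.cong)
        also have "sum r (V - {u} - {q}) = sum r V - r u - r q" using V qu u by (simp add: sum_diff1)
        also have "r' q = r q + (r u + mass (L u) powr \<alpha> * dist q u)" by (simp add: r'_def)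
        finally show ?thesis using fin q wq by (simp add: E'_def M_alpha_def sum_diff1)
      qed
      ultimately show ?thesis by (simp only: U)
    qed
  qed
qed

lemma transport_path_tree:
  assumes A: "finite A" and path: "transport_path (masses A (\<lambda>_. x)) (masses A y) V E w"
  shows "tree UNIV x A (M_alpha \<alpha> E w)"
proof -
  let ?a = "Poly_Mapping.single x (mass A)" and ?c = "masses A y"
  have "pos_flow ?a ?c E (\<lambda>e. if e \<in> E then w e else 0)" "acyclic E"
    using transport_path_flow(1)[OF path] path by (auto simp: masses_const transport_path_def)
  then obtain E' w' where w': "pos_flow ?a ?c E' w'" "acyclic E'"
    "\<And>u v v'. (v, u) \<in> E' \<Longrightarrow> (v', u) \<in> E' \<Longrightarrow> v = v'" "M_alpha \<alpha> E' w' \<le> M_alpha \<alpha> E w"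
    using indegree_reduction[of \<alpha> ?c x "mass A" E] alpha transport_path_flow(2)[OF path]
      lookup_masses[OF A, of y] by (smt (verit, best) mass_nonneg)
  define V' where "V' = {x} \<union> fst ` E' \<union> snd ` E' \<union> y ` A"
  define L where "L = (\<lambda>u. {h\<in>A. y h = u})"
  have fin: "finite E'" using w'(1) by (simp add: pos_flow_def flow_def)
  have U: "\<Union>(L ` V') = A" by (auto simp: L_def V'_def)
  have own: "B \<subseteq> A \<Longrightarrow> (\<And>h. h \<in> B \<Longrightarrow> y h = u) \<Longrightarrow> tree UNIV u B 0" for u B
  proof (induction B rule: infinite_finite_induct)
    case (infinite B)
    then show ?case using A finite_subset by blast
  next
    case empty
    show ?case by (rule tree.empty)
  next
    case (insert h B)
    then show ?case using tree.join[OF tree.own[of h u] insert.IH] by auto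
  qed
  have "tree UNIV x (\<Union>(L ` V')) (sum (\<lambda>_. 0) V' + M_alpha \<alpha> E' w')"
  proof (rule forest_tree)
    show "E' \<subseteq> V' \<times> V'" 
    proof
      fix e assume "e \<in> E'"
      then show "e \<in> V' \<times> V'" unfolding V'_def by (metis UnI1 UnI2 image_eqI mem_Times_iff)
    qed
    show "net E' w' u = (if u = x then mass (\<Union>(L ` V')) else 0) - mass (L u)" for u
      using w'(1) unfolding U by (simp add: pos_flow_def flow_def lookup_masses[OF A] L_def lookup_single)
    show "tree UNIV u (L u) 0" for u by (rule own) (auto simp: L_def)
    show "v = v'" if "(v, u) \<in> E'" "(v', u) \<in> E'" for u v v' using w'(3) that by blast
    show "acyclic E'" by (rule w'(2))
  qed (use A fin w'(1) in \<open>auto simp: V'_def L_def pos_flow_def\<close>)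
  then have "tree UNIV x A (M_alpha \<alpha> E' w')" unfolding U by simp
  then show ?thesis by (rule tree.edge[where v = x]) (use w'(4) in auto)
qed

end

section \<open>Cutting a tree at a level\<close>

lemma norm_axis_decomp:
  fixes v w :: "'a::real_inner"
  assumes "norm v = 1"
  shows "(norm w)\<^sup>2 = (w \<bullet> v)\<^sup>2 + (norm (w - (w \<bullet> v) *\<^sub>R v))\<^sup>2"
proof -
  have "v \<bullet> v = 1" using assms by (simp add: dot_square_norm)
  then show ?thesis
    unfolding power2_norm_eq_inner
    by (simp add: inner_diff_left inner_diff_right inner_commute power2_eq_square algebra_simps)
qed

lemma axis_coord_diff: "axis_coord p v a - axis_coord p v b = (a - b) \<bullet> v"
  by (simp add: axis_coord_def inner_diff_left)

lemma axis_coord_dist: "norm v = 1 \<Longrightarrow> \<bar>axis_coord p v a - axis_coord p v b\<bar> \<le> dist a b"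
  unfolding axis_coord_diff dist_norm using Cauchy_Schwarz_ineq2[of "a - b" v] by simp

lemma axis_crossing:
  fixes a b :: "'a::euclidean_space"
  assumes "axis_coord p v b \<le> t" "t < axis_coord p v a"
  shows "\<exists>z\<in>closed_segment a b. axis_coord p v z = t \<and> dist a z + dist z b = dist a b"
proof -
  define \<tau> where "\<tau> = (axis_coord p v a - t) / (axis_coord p v a - axis_coord p v b)"
  have \<tau>: "0 \<le> \<tau>" "\<tau> \<le> 1" "\<tau> * (axis_coord p v a - axis_coord p v b) = axis_coord p v a - t"
    using assms by (auto simp: \<tau>_def)
  let ?z = "a + \<tau> *\<^sub>R (b - a)"
  have "?z = (1 - \<tau>) *\<^sub>R a + \<tau> *\<^sub>R b" by (simp add: algebra_simps)
  then have mem: "?z \<in> closed_segment a b" using \<tau> unfolding closed_segment_def by blast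
  have "axis_coord p v ?z = axis_coord p v a - \<tau> * (axis_coord p v a - axis_coord p v b)"
    by (simp add: axis_coord_def inner_diff_left inner_add_left algebra_simps)
  moreover have "dist a ?z + dist ?z b = dist a b"
  proof -
    have "a - ?z = \<tau> *\<^sub>R (a - b)" "?z - b = (1 - \<tau>) *\<^sub>R (a - b)" by (simp_all add: algebra_simps)
    then show ?thesis using \<tau> by (simp add: dist_norm flip: distrib_right)
  qed
  ultimately show ?thesis using mem \<tau> by (intro bexI[of _ ?z]) auto
qed

context irrigation
begin

definition sourced :: "'a set \<Rightarrow> nat set \<Rightarrow> real \<Rightarrow> bool" where
  "sourced J A r \<longleftrightarrow> (\<exists>z. z ` A \<subseteq> J \<and> moves z y A r)"

lemma sourced_mono:
  assumes "sourced J A r" "J \<subseteq> J'" "r \<le> s"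
  shows "sourced J' A s"
proof -
  obtain z where z: "z ` A \<subseteq> J" "moves z y A r" using assms(1) unfolding sourced_def by blast
  have "moves z y A s" by (rule moves_mono[OF z(2) assms(3)])
  then show ?thesis unfolding sourced_def using z(1) assms(2) by blast
qed

lemma sourced_empty: "sourced J {} 0"
  unfolding sourced_def by (rule exI[of _ y]) (simp add: moves_refl)

lemma sourced_own: "y h \<in> J \<Longrightarrow> sourced J {h} 0"
  unfolding sourced_def by (rule exI[of _ y]) (simp add: moves_refl)

lemma moves_source_cong:
  assumes "moves z w A r" "\<And>h. h \<in> A \<Longrightarrow> z h = z' h"
  shows "moves z' w A r"
proof -
  have "masses A z = masses A z'" by (rule masses_cong) (rule assms(2))
  then show ?thesis using assms(1) unfolding moves_def by simp
qed

lemma moves_congI: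
  assumes "moves z w A r" "\<And>h. h \<in> A \<Longrightarrow> z h = z' h" "\<And>h. h \<in> A \<Longrightarrow> w h = w' h" "r \<le> s"
  shows "moves z' w' A s"
proof -
  have "masses A z = masses A z'" by (rule masses_cong) (rule assms(2))
  moreover have "masses A w = masses A w'" by (rule masses_cong) (rule assms(3))
  ultimately have "moves z' w' A r" using assms(1) unfolding moves_def by simp
  then show ?thesis using assms(4) by (rule moves_mono)
qed

lemma sourced_union:
  assumes "finite A" "finite B" "A \<inter> B = {}" "sourced J A r" "sourced J B s"
  shows "sourced J (A \<union> B) (r + s)"
proof -
  obtain z z' where z: "z ` A \<subseteq> J" "moves z y A r" "z' ` B \<subseteq> J" "moves z' y B s"
    using assms(4,5) unfolding sourced_def by blast
  let ?z = "\<lambda>h. if h \<in> A then z h else z' h"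
  have "moves ?z y A r" by (rule moves_source_cong[OF z(2)]) simp
  moreover have "moves ?z y B s" by (rule moves_source_cong[OF z(4)]) (use assms(3) in auto)
  ultimately have "moves ?z y (A \<union> B) (r + s)" using assms by (intro moves_union)
  moreover have "?z ` (A \<union> B) \<subseteq> J" using z(1,3) by auto
  ultimately show ?thesis unfolding sourced_def by blast
qed

lemma sourced_singleton: "sourced {u} A r \<longleftrightarrow> moves (\<lambda>_. u) y A r"
proof
  assume "sourced {u} A r"
  then obtain z where z: "z ` A \<subseteq> {u}" "moves z y A r" unfolding sourced_def by blast
  show "moves (\<lambda>_. u) y A r" by (rule moves_source_cong[OF z(2)]) (use z(1) in auto)
next
  assume "moves (\<lambda>_. u) y A r"
  then show "sourced {u} A r" unfolding sourced_def by (intro exI[of _ "\<lambda>_. u"]) auto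
qed

lemma sourced_move:
  assumes "sourced {c} A r"
  shows "sourced {u} A (r + mass A powr \<alpha> * dist u c)"
  using moves_trans[OF moves_const[of u c A]] assms unfolding sourced_singleton by (simp add: add.commute)

text \<open>
  The tree is cut where it first meets the level \<open>\<pi> = lo\<close>. The relation \<open>comp u J g\<close> says that when the
  tree above the cut is followed down to \<open>u\<close>, the part of it that stays above the level may be
  supplied from anywhere in \<open>J\<close>, and that the part below still saves \<open>g\<close> per unit of
  \<open>mass powr \<alpha>\<close>.
\<close>

lemma tree_cut:
  fixes \<pi> :: "'a \<Rightarrow> real" and comp :: "'a \<Rightarrow> 'a set \<Rightarrow> real \<Rightarrow> bool"
  assumes "tree K u A r" "lo < \<pi> u" "comp u J g"
    and "\<And>h. h \<in> A \<Longrightarrow> \<pi> (y h) \<le> lo \<or> hi \<le> \<pi> (y h)"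
    and cross: "\<And>u v. u \<in> K \<Longrightarrow> v \<in> K \<Longrightarrow> lo < \<pi> u \<Longrightarrow> \<pi> v \<le> lo \<Longrightarrow>
      \<exists>z\<in>L. dist u z + dist z v = dist u v \<and> \<pi> u - lo \<le> dist u z"
    and comp_own: "\<And>u J g. comp u J g \<Longrightarrow> hi \<le> \<pi> u \<Longrightarrow> u \<in> J"
    and comp_bound: "\<And>u J g. comp u J g \<Longrightarrow> lo < \<pi> u \<Longrightarrow> 0 \<le> g \<and> g \<le> \<pi> u - lo"
    and comp_step: "\<And>u v J g. u \<in> K \<Longrightarrow> v \<in> K \<Longrightarrow> lo < \<pi> u \<Longrightarrow> lo < \<pi> v \<Longrightarrow> comp u J g \<Longrightarrow>
      \<exists>J' g'. comp v J' g' \<and> (\<forall>A r b. finite A \<longrightarrow> 0 \<le> b \<longrightarrow> sourced J' A r \<longrightarrow>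
         sourced J A (r + ((mass A + b) powr \<alpha> * dist u v + b powr \<alpha> * (g' - g))))"
  shows "\<exists>B r1 r2. B \<subseteq> A \<and> (\<forall>h\<in>A. \<pi> (y h) \<le> lo \<longrightarrow> h \<in> B) \<and> sourced J (A - B) r1 \<and>
           sourced L B r2 \<and> r1 + r2 + mass B powr \<alpha> * g \<le> r"
  using assms(1-4)
proof (induction arbitrary: J g rule: tree.induct)
  case (empty u)
  have "sourced J ({} - {}) 0" "sourced L {} 0" using sourced_empty by simp_all
  then show ?case by (intro exI[of _ "{}"] exI[of _ 0] conjI) simp_all
next
  case (own h u)
  then have "u \<in> J" using comp_own[of u J g] by auto
  then have "sourced J ({h} - {}) 0" using own sourced_own[of h J] by simp
  moreover have "\<not> \<pi> (y h) \<le> lo" using own by simp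
  ultimately show ?case using sourced_empty[of L]
    by (intro exI[of _ "{}"] exI[of _ 0] conjI) simp_all
next
  case (join u A r A' r')
  obtain B r1 r2 where B: "B \<subseteq> A" "\<forall>h\<in>A. \<pi> (y h) \<le> lo \<longrightarrow> h \<in> B" "sourced J (A - B) r1"
    "sourced L B r2" "r1 + r2 + mass B powr \<alpha> * g \<le> r"
    using join.IH(1)[OF join.prems(1,2)] join.prems(3) by blast
  obtain B' r1' r2' where B': "B' \<subseteq> A'" "\<forall>h\<in>A'. \<pi> (y h) \<le> lo \<longrightarrow> h \<in> B'" "sourced J (A' - B') r1'"
    "sourced L B' r2'" "r1' + r2' + mass B' powr \<alpha> * g \<le> r'"
    using join.IH(2)[OF join.prems(1,2)] join.prems(3) by blast
  have fin: "finite A" "finite A'" "finite B" "finite B'"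
    using tree_finite join.hyps B(1) B'(1) finite_subset by blast+
  have "sourced J ((A - B) \<union> (A' - B')) (r1 + r1')"
    using B B' fin join.hyps by (intro sourced_union) auto
  moreover have "(A - B) \<union> (A' - B') = (A \<union> A') - (B \<union> B')" using B(1) B'(1) join.hyps(3) by auto
  moreover have "sourced L (B \<union> B') (r2 + r2')"
    using B B' fin join.hyps by (intro sourced_union) auto
  moreover have "mass (B \<union> B') powr \<alpha> * g \<le> (mass B powr \<alpha> + mass B' powr \<alpha>) * g"
  proof (rule mult_right_mono)
    have "mass (B \<union> B') = mass B + mass B'"
      using fin B(1) B'(1) join.hyps(3) by (intro sum.union_disjoint) auto
    then show "mass (B \<union> B') powr \<alpha> \<le> mass B powr \<alpha> + mass B' powr \<alpha>"
      using powr_subadd[of \<alpha> "mass B" "mass B'"] alpha by simp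
    show "0 \<le> g" using comp_bound[OF join.prems(2,1)] by simp
  qed
  ultimately have "sourced J ((A \<union> A') - (B \<union> B')) (r1 + r1')" "sourced L (B \<union> B') (r2 + r2')"
    "(r1 + r1') + (r2 + r2') + mass (B \<union> B') powr \<alpha> * g \<le> r + r'"
    using B(5) B'(5) by (simp_all add: distrib_right)
  moreover have "B \<union> B' \<subseteq> A \<union> A'" "\<forall>h\<in>A \<union> A'. \<pi> (y h) \<le> lo \<longrightarrow> h \<in> B \<union> B'"
    using B(1,2) B'(1,2) by blast+
  ultimately show ?case by blast
next
  case (edge v A r u s)
  have fin: "finite A" using edge.hyps(1) by (rule tree_finite)
  show ?case
  proof (cases "lo < \<pi> v")
    case False
    then obtain z where z: "z \<in> L" "dist u z + dist z v = dist u v" "\<pi> u - lo \<le> dist u z"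
      using cross[of u v] edge by (metis not_less)
    have v: "sourced {v} A r" unfolding sourced_singleton using edge.hyps(1) by (rule tree_moves)
    have "sourced L A (r + mass A powr \<alpha> * dist z v)"
      by (rule sourced_mono[OF sourced_move[OF v, of z]]) (use z(1) in auto)
    moreover have "mass A powr \<alpha> * g \<le> mass A powr \<alpha> * dist u z"
      using comp_bound[OF edge.prems(2,1)] z(3) by (intro mult_left_mono) auto
    moreover have "mass A powr \<alpha> * dist u v = mass A powr \<alpha> * dist u z + mass A powr \<alpha> * dist z v"
      unfolding z(2)[symmetric] by (rule distrib_left)
    ultimately have "sourced L A (r + mass A powr \<alpha> * dist z v)"
      "0 + (r + mass A powr \<alpha> * dist z v) + mass A powr \<alpha> * g \<le> s"
      using edge.hyps(4) by simp_all
    moreover have "sourced J (A - A) 0" using sourced_empty by simp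
    ultimately show ?thesis by blast
  next
    case True
    obtain J' g' where J': "comp v J' g'" "\<And>A r b. finite A \<Longrightarrow> 0 \<le> b \<Longrightarrow> sourced J' A r \<Longrightarrow>
         sourced J A (r + ((mass A + b) powr \<alpha> * dist u v + b powr \<alpha> * (g' - g)))"
      using comp_step[OF edge.hyps(2,3) edge.prems(1) True edge.prems(2)] by blast
    obtain B r1 r2 where B: "B \<subseteq> A" "\<forall>h\<in>A. \<pi> (y h) \<le> lo \<longrightarrow> h \<in> B" "sourced J' (A - B) r1"
      "sourced L B r2" "r1 + r2 + mass B powr \<alpha> * g' \<le> r"
      using edge.IH[OF True J'(1)] edge.prems(3) by blast
    have "sourced J (A - B) (r1 + (mass A powr \<alpha> * dist u v + mass B powr \<alpha> * (g' - g)))"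
      using J'(2)[OF _ mass_nonneg[of B] B(3)] fin B(1) by (simp add: sum_diff finite_subset)
    moreover have "(r1 + (mass A powr \<alpha> * dist u v + mass B powr \<alpha> * (g' - g))) + r2 + mass B powr \<alpha> * g \<le> s"
      using B(5) edge.hyps(4) by (simp add: right_diff_distrib)
    ultimately show ?thesis using B(1,2,4) by blast
  qed
qed

lemma segment_irrigation:
  assumes "norm e \<le> 1" "finite A" "\<And>h. h \<in> A \<Longrightarrow> 0 \<le> s h \<and> s h \<le> len" "0 \<le> len"
  shows "moves (\<lambda>_. c) (\<lambda>h. c + s h *\<^sub>R e) A (mass A powr \<alpha> * len)"
  using assms(2-)
proof (induction "card A" arbitrary: A c s len)
  case 0
  then show ?case by (intro moves_refl) auto
next
  case (Suc k)
  then have ne: "A \<noteq> {}" by auto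
  define h0 where "h0 = arg_min_on s A"
  have h0: "h0 \<in> A" "\<And>h. h \<in> A \<Longrightarrow> s h0 \<le> s h"
    unfolding h0_def using arg_min_if_finite[OF Suc.prems(1) ne] arg_min_least[OF Suc.prems(1) ne] by auto
  let ?c = "c + s h0 *\<^sub>R e"
  have "moves (\<lambda>_. ?c) (\<lambda>h. ?c + (s h - s h0) *\<^sub>R e) (A - {h0}) (mass (A - {h0}) powr \<alpha> * (len - s h0))"
    by (rule Suc.hyps(1)) (use Suc.hyps(2) Suc.prems h0 in \<open>auto\<close>)
  then have "moves (\<lambda>_. ?c) (\<lambda>h. c + s h *\<^sub>R e) (A - {h0}) (mass A powr \<alpha> * (len - s h0))"
  proof (rule moves_congI)
    show "mass (A - {h0}) powr \<alpha> * (len - s h0) \<le> mass A powr \<alpha> * (len - s h0)"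
      using Suc.prems h0(1) mass_powr_mono[of A "A - {h0}"] by (intro mult_right_mono) auto
  qed (simp_all add: scaleR_left_diff_distrib)
  moreover have "moves (\<lambda>_. ?c) (\<lambda>h. c + s h *\<^sub>R e) {h0} 0" by (rule moves_refl) auto
  ultimately have "moves (\<lambda>_. ?c) (\<lambda>h. c + s h *\<^sub>R e) ({h0} \<union> (A - {h0})) (0 + mass A powr \<alpha> * (len - s h0))"
    using Suc.prems by (intro moves_union) auto
  moreover have "{h0} \<union> (A - {h0}) = A" using h0 by auto
  ultimately have "moves (\<lambda>_. ?c) (\<lambda>h. c + s h *\<^sub>R e) A (mass A powr \<alpha> * (len - s h0))" by simp
  moreover have "moves (\<lambda>_. c) (\<lambda>_. ?c) A (mass A powr \<alpha> * s h0)"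
  proof (rule moves_mono[OF moves_const])
    have "dist c ?c \<le> s h0 * 1" using Suc.prems(2)[OF h0(1)] assms(1)
      by (simp add: dist_norm mult_left_le)
    then show "mass A powr \<alpha> * dist c ?c \<le> mass A powr \<alpha> * s h0" by (intro mult_left_mono) auto
  qed
  ultimately have "moves (\<lambda>_. c) (\<lambda>h. c + s h *\<^sub>R e) A (mass A powr \<alpha> * s h0 + mass A powr \<alpha> * (len - s h0))"
    using moves_trans by blast
  then show ?case by (simp add: algebra_simps)
qed

lemma line_clamp:
  assumes e: "norm e \<le> 1" and A: "finite A" and l: "l' \<le> l" "l \<le> r" "r \<le> r'"
    and s: "\<And>h. h \<in> A \<Longrightarrow> l' \<le> s h \<and> s h \<le> r'"
  shows "moves (\<lambda>h. c + max l (min r (s h)) *\<^sub>R e) (\<lambda>h. c + s h *\<^sub>R e) A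
           (mass A powr \<alpha> * ((r' - r) + (l - l')))"
proof -
  let ?z = "\<lambda>h. c + max l (min r (s h)) *\<^sub>R e" and ?w = "\<lambda>h. c + s h *\<^sub>R e"
  let ?A1 = "{h\<in>A. r < s h}" and ?A2 = "{h\<in>A. s h < l}" and ?A0 = "{h\<in>A. l \<le> s h \<and> s h \<le> r}"
  have "moves (\<lambda>_. c + r *\<^sub>R e) (\<lambda>h. (c + r *\<^sub>R e) + (s h - r) *\<^sub>R e) ?A1 (mass ?A1 powr \<alpha> * (r' - r))"
    by (rule segment_irrigation[OF e]) (use A s l in fastforce)+
  then have 1: "moves ?z ?w ?A1 (mass A powr \<alpha> * (r' - r))"
  proof (rule moves_congI)
    show "mass ?A1 powr \<alpha> * (r' - r) \<le> mass A powr \<alpha> * (r' - r)"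
      using A l mass_powr_mono[of A ?A1] by (intro mult_right_mono) auto
  qed (use l in \<open>simp_all add: scaleR_left_diff_distrib\<close>)
  have "moves (\<lambda>_. c + l *\<^sub>R e) (\<lambda>h. (c + l *\<^sub>R e) + (l - s h) *\<^sub>R (- e)) ?A2 (mass ?A2 powr \<alpha> * (l - l'))"
    by (rule segment_irrigation) (use A s l e in fastforce)+
  then have 2: "moves ?z ?w ?A2 (mass A powr \<alpha> * (l - l'))"
  proof (rule moves_congI)
    show "mass ?A2 powr \<alpha> * (l - l') \<le> mass A powr \<alpha> * (l - l')"
      using A l mass_powr_mono[of A ?A2] by (intro mult_right_mono) auto
  qed (use l in \<open>simp_all add: scaleR_left_diff_distrib\<close>)
  have 0: "moves ?z ?w ?A0 0" using l by (intro moves_refl) auto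
  have "moves ?z ?w (?A1 \<union> ?A2 \<union> ?A0) (mass A powr \<alpha> * (r' - r) + mass A powr \<alpha> * (l - l') + 0)"
    using A l by (intro moves_union 0 1 2) auto
  moreover have "?A1 \<union> ?A2 \<union> ?A0 = A" by auto
  ultimately show ?thesis by (simp add: algebra_simps)
qed

lemma sourced_line_shrink:
  assumes e: "norm e \<le> 1" and A: "finite A" and l: "l' \<le> l" "l \<le> r" "r \<le> r'"
    and "sourced ((\<lambda>s. c + s *\<^sub>R e) ` {l'..r'}) A \<rho>"
  shows "sourced ((\<lambda>s. c + s *\<^sub>R e) ` {l..r}) A (\<rho> + mass A powr \<alpha> * ((r' - r) + (l - l')))"
proof -
  obtain z where z: "z ` A \<subseteq> (\<lambda>s. c + s *\<^sub>R e) ` {l'..r'}" "moves z y A \<rho>"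
    using assms unfolding sourced_def by blast
  then have "\<forall>h\<in>A. \<exists>s. l' \<le> s \<and> s \<le> r' \<and> z h = c + s *\<^sub>R e" by fastforce
  then obtain s where s: "\<And>h. h \<in> A \<Longrightarrow> l' \<le> s h \<and> s h \<le> r'" "\<And>h. h \<in> A \<Longrightarrow> z h = c + s h *\<^sub>R e"
    by metis
  have "moves (\<lambda>h. c + s h *\<^sub>R e) y A \<rho>" by (rule moves_source_cong[OF z(2)]) (rule s(2))
  from moves_trans[OF line_clamp[OF e A l s(1)] this]
  have "moves (\<lambda>h. c + max l (min r (s h)) *\<^sub>R e) y A (\<rho> + mass A powr \<alpha> * ((r' - r) + (l - l')))"
    by (simp add: add.commute)
  moreover have "c + max l (min r t) *\<^sub>R e \<in> (\<lambda>s. c + s *\<^sub>R e) ` {l..r}" for t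
    using l by (intro imageI) auto
  then have "(\<lambda>h. c + max l (min r (s h)) *\<^sub>R e) ` A \<subseteq> (\<lambda>s. c + s *\<^sub>R e) ` {l..r}" by blast
  ultimately show ?thesis unfolding sourced_def by blast
qed

section \<open>Dyadic irrigation of a cube\<close>

lemma moves_UNION:
  assumes "finite I" "\<And>i. i \<in> I \<Longrightarrow> finite (A i)"
    and "\<And>i i'. i \<in> I \<Longrightarrow> i' \<in> I \<Longrightarrow> i \<noteq> i' \<Longrightarrow> A i \<inter> A i' = {}"
    and "\<And>i. i \<in> I \<Longrightarrow> moves z z' (A i) (r i)"
  shows "moves z z' (\<Union>i\<in>I. A i) (\<Sum>i\<in>I. r i)"
  using assms
proof (induction I rule: finite_induct)
  case empty
  show ?case using moves_refl[of "{}" z z' 0] by simp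
next
  case (insert i I)
  have "moves z z' (\<Union>i\<in>I. A i) (\<Sum>i\<in>I. r i)"
    by (rule insert.IH) (use insert.prems in blast)+
  moreover have "A i \<inter> (\<Union>i\<in>I. A i) = {}" using insert.prems(2) insert.hyps(2) by blast
  ultimately have "moves z z' (A i \<union> (\<Union>i\<in>I. A i)) (r i + (\<Sum>i\<in>I. r i))"
    using insert.prems(1,3) insert.hyps(1) by (intro moves_union) blast+
  then show ?case using insert.hyps by simp
qed

lemma moves_star:
  assumes A: "finite A" and D: "\<And>h. h \<in> A \<Longrightarrow> dist c (z h) \<le> D"
  shows "moves (\<lambda>_. c) z A (real (card A) * (mass A powr \<alpha> * D))"
proof -
  have "moves (\<lambda>_. c) z (\<Union>h\<in>A. {h}) (\<Sum>h\<in>A. mass A powr \<alpha> * D)"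
  proof (rule moves_UNION[OF A])
    fix h assume h: "h \<in> A"
    show "moves (\<lambda>_. c) z {h} (mass A powr \<alpha> * D)"
    proof (rule moves_congI[OF moves_const[of c "z h" "{h}"]])
      show "mass {h} powr \<alpha> * dist c (z h) \<le> mass A powr \<alpha> * D"
        using h A mass_powr_mono[of A "{h}"] D[OF h] by (intro mult_mono) auto
    qed auto
  qed auto
  then show ?thesis by simp
qed

text \<open>
  The \<open>s\<close>-th approximation sends the mass through the centres of the dyadic subcubes down to depth
  \<open>s\<close> and then straight to the targets; \<open>\<kappa>\<close> is the fixed point of \<open>\<kappa> = (q / 2) * (1 + \<kappa>)\<close>.
\<close>

lemma dyadic_irrigation:
  assumes Bs: "finite Bs" "pairwise orthogonal Bs" "\<And>e. e \<in> Bs \<Longrightarrow> norm e = 1"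
    and q: "q = 2 powr (real (card Bs) * (1 - \<alpha>))" and \<kappa>: "\<kappa> = q / 2 * (1 + \<kappa>)" "0 \<le> \<kappa>"
    and A: "finite A" and L: "0 \<le> L"
    and c: "\<And>h e. h \<in> A \<Longrightarrow> e \<in> Bs \<Longrightarrow> \<bar>c h e\<bar> \<le> L"
  shows "moves (\<lambda>_. o') (\<lambda>h. o' + (\<Sum>e\<in>Bs. c h e *\<^sub>R e)) A
           (mass A powr \<alpha> * (sqrt (card Bs) * L) * (\<kappa> + (real (card A) - \<kappa>) / 2 ^ s) )"
proof -
  have norm_le: "norm (\<Sum>e\<in>Bs. f e *\<^sub>R e) \<le> sqrt (card Bs) * K"
    if "0 \<le> K" "\<And>e. e \<in> Bs \<Longrightarrow> \<bar>f e\<bar> \<le> K" for f and K :: real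
  proof (rule power2_le_imp_le)
    have "(norm (\<Sum>e\<in>Bs. f e *\<^sub>R e))\<^sup>2 = (\<Sum>e\<in>Bs. (norm (f e *\<^sub>R e))\<^sup>2)"
      using pairwise_ortho_scaleR[of "\<lambda>x. x" "\<lambda>x. x" Bs f] Bs(1,2)
      by (intro norm_sum_Pythagorean) auto
    also have "\<dots> \<le> (\<Sum>e\<in>Bs. K\<^sup>2)"
      using that Bs(3) by (intro sum_mono) (simp add: abs_le_square_iff[symmetric])
    finally show "(norm (\<Sum>e\<in>Bs. f e *\<^sub>R e))\<^sup>2 \<le> (sqrt (card Bs) * K)\<^sup>2"
      by (simp add: power_mult_distrib)
  qed (use that in simp)
  show ?thesis using A L c
  proof (induction s arbitrary: A L c o')
    case 0
    have "moves (\<lambda>_. o') (\<lambda>h. o' + (\<Sum>e\<in>Bs. c h e *\<^sub>R e)) A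
        (real (card A) * (mass A powr \<alpha> * (sqrt (card Bs) * L)))"
      using 0 norm_le by (intro moves_star) (auto simp: dist_norm)
    then show ?case by (simp add: mult_ac)
  next
    case (Suc s)
    define P where "P \<sigma> = {h\<in>A. {e\<in>Bs. 0 \<le> c h e} = \<sigma>}" for \<sigma>
    define g where "g \<sigma> e = (if e \<in> \<sigma> then L / 2 else - L / 2)" for \<sigma> and e :: 'a
    define o2 where "o2 \<sigma> = o' + (\<Sum>e\<in>Bs. g \<sigma> e *\<^sub>R e)" for \<sigma>
    let ?z = "\<lambda>h. o' + (\<Sum>e\<in>Bs. c h e *\<^sub>R e)"
    let ?D = "sqrt (card Bs) * (L / 2)"
    let ?r = "\<lambda>\<sigma>. mass (P \<sigma>) powr \<alpha> * ?D + mass (P \<sigma>) powr \<alpha> * ?D * (\<kappa> + (real (card (P \<sigma>)) - \<kappa>) / 2 ^ s)"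
    have fin: "finite (P \<sigma>)" for \<sigma> using Suc.prems(1) by (simp add: P_def)
    have U: "(\<Union>\<sigma>\<in>Pow Bs. P \<sigma>) = A"
    proof (intro equalityI subsetI)
      fix h assume "h \<in> A"
      then have "h \<in> P {e\<in>Bs. 0 \<le> c h e}" by (simp add: P_def)
      moreover have "{e\<in>Bs. 0 \<le> c h e} \<in> Pow Bs" by (rule PowI) (rule Collect_restrict)
      ultimately show "h \<in> (\<Union>\<sigma>\<in>Pow Bs. P \<sigma>)" by (rule UN_I[rotated])
    next
      fix h assume "h \<in> (\<Union>\<sigma>\<in>Pow Bs. P \<sigma>)"
      then obtain \<sigma> where "h \<in> P \<sigma>" by (rule UN_E)
      then show "h \<in> A" unfolding P_def by simp
    qed
    have disj: "P \<sigma> \<inter> P \<tau> = {}" if "\<sigma> \<noteq> \<tau>" for \<sigma> \<tau>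
      unfolding P_def using that by blast
    have piece: "moves (\<lambda>_. o') ?z (P \<sigma>) (?r \<sigma>)" if "\<sigma> \<in> Pow Bs" for \<sigma>
    proof (rule moves_trans)
      have "dist o' (o2 \<sigma>) \<le> ?D"
        using norm_le[of "L / 2" "g \<sigma>"] Suc.prems(2) by (simp add: o2_def dist_norm g_def)
      then show "moves (\<lambda>_. o') (\<lambda>_. o2 \<sigma>) (P \<sigma>) (mass (P \<sigma>) powr \<alpha> * ?D)"
        by (intro moves_mono[OF moves_const] mult_left_mono) auto
      have "\<bar>c h e - g \<sigma> e\<bar> \<le> L / 2" if "h \<in> P \<sigma>" "e \<in> Bs" for h e
      proof -
        have "\<bar>c h e\<bar> \<le> L" "e \<in> \<sigma> \<longleftrightarrow> 0 \<le> c h e" using that Suc.prems(3) by (auto simp: P_def)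
        moreover from this have "g \<sigma> e = L / 2 \<and> 0 \<le> c h e \<or> g \<sigma> e = - L / 2 \<and> c h e < 0"
          by (auto simp: g_def)
        ultimately show ?thesis by linarith
      qed
      then have "moves (\<lambda>_. o2 \<sigma>) (\<lambda>h. o2 \<sigma> + (\<Sum>e\<in>Bs. (c h e - g \<sigma> e) *\<^sub>R e)) (P \<sigma>)
          (mass (P \<sigma>) powr \<alpha> * ?D * (\<kappa> + (real (card (P \<sigma>)) - \<kappa>) / 2 ^ s))"
        using fin Suc.prems(2) by (intro Suc.IH) auto
      moreover have "o2 \<sigma> + (\<Sum>e\<in>Bs. (c h e - g \<sigma> e) *\<^sub>R e) = ?z h" for h
        by (simp add: o2_def scaleR_left_diff_distrib sum_subtractf)
      ultimately show "moves (\<lambda>_. o2 \<sigma>) ?z (P \<sigma>)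
          (mass (P \<sigma>) powr \<alpha> * ?D * (\<kappa> + (real (card (P \<sigma>)) - \<kappa>) / 2 ^ s))" by simp
    qed
    have "moves (\<lambda>_. o') ?z (\<Union>\<sigma>\<in>Pow Bs. P \<sigma>) (\<Sum>\<sigma>\<in>Pow Bs. ?r \<sigma>)"
      using Bs(1) fin disj piece by (intro moves_UNION) auto
    then have total: "moves (\<lambda>_. o') ?z A (\<Sum>\<sigma>\<in>Pow Bs. ?r \<sigma>)" unfolding U .
    define N where "N = real (card A)"
    define \<Phi> where "\<Phi> = mass A powr \<alpha>"
    have "q = real (card (Pow Bs)) powr (1 - \<alpha>)"
      using q Bs(1) by (simp add: card_Pow powr_powr flip: powr_realpow)
    moreover have "sum (\<lambda>\<sigma>. mass (P \<sigma>)) (Pow Bs) = mass A"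
      using sum.UNION_disjoint[of "Pow Bs" P n] Bs(1) fin disj unfolding U by simp
    ultimately have powers: "(\<Sum>\<sigma>\<in>Pow Bs. mass (P \<sigma>) powr \<alpha>) \<le> q * \<Phi>"
      using sum_powr_le[of \<alpha> "Pow Bs" "\<lambda>\<sigma>. mass (P \<sigma>)"] alpha Bs(1) by (simp add: \<Phi>_def)
    have "card A = (\<Sum>\<sigma>\<in>Pow Bs. card (P \<sigma>))"
      using card_UN_disjoint[of "Pow Bs" P] Bs(1) fin disj unfolding U by simp
    then have N: "N = (\<Sum>\<sigma>\<in>Pow Bs. real (card (P \<sigma>)))" unfolding N_def by simp
    have "mass (P \<sigma>) powr \<alpha> \<le> \<Phi>" for \<sigma>
      unfolding \<Phi>_def using Suc.prems(1) by (rule mass_powr_mono) (auto simp: P_def)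
    then have cards: "(\<Sum>\<sigma>\<in>Pow Bs. mass (P \<sigma>) powr \<alpha> * real (card (P \<sigma>))) \<le> \<Phi> * N"
      unfolding N sum_distrib_left by (intro sum_mono mult_right_mono) simp_all
    have D: "0 \<le> ?D" using Suc.prems(2) by simp
    have "\<kappa> * 1 \<le> \<kappa> * 2 ^ s" using \<kappa>(2) by (intro mult_left_mono) simp_all
    then have pow: "\<kappa> / 2 ^ s \<le> \<kappa>" "0 \<le> \<kappa> / 2 ^ s" using \<kappa>(2) by (simp_all add: field_simps)
    have q1: "1 \<le> q" unfolding q using alpha by (intro ge_one_powr_ge_zero) auto
    let ?S = "\<Sum>\<sigma>\<in>Pow Bs. mass (P \<sigma>) powr \<alpha>"
      and ?C = "\<Sum>\<sigma>\<in>Pow Bs. mass (P \<sigma>) powr \<alpha> * real (card (P \<sigma>))"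
    have "?r \<sigma> = ?D * ((1 + \<kappa> - \<kappa> / 2 ^ s) * mass (P \<sigma>) powr \<alpha> +
        (mass (P \<sigma>) powr \<alpha> * real (card (P \<sigma>))) * (1 / 2 ^ s))" for \<sigma>
      by (simp add: algebra_simps diff_divide_distrib)
    then have "(\<Sum>\<sigma>\<in>Pow Bs. ?r \<sigma>) = ?D * ((1 + \<kappa> - \<kappa> / 2 ^ s) * ?S + ?C * (1 / 2 ^ s))"
      by (simp only: sum.distrib flip: sum_distrib_left sum_distrib_right)
    also have "\<dots> \<le> ?D * ((1 + \<kappa> - \<kappa> / 2 ^ s) * (q * \<Phi>) + \<Phi> * N * (1 / 2 ^ s))"
      using powers cards D pow by (intro mult_left_mono add_mono mult_right_mono) auto
    also have "\<dots> = \<Phi> * (sqrt (card Bs) * L) * (q / 2 * (1 + \<kappa>) + (N - q * \<kappa>) / 2 ^ Suc s)"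
      by (simp add: field_simps)
    also have "\<dots> \<le> \<Phi> * (sqrt (card Bs) * L) * (\<kappa> + (N - \<kappa>) / 2 ^ Suc s)"
    proof (rule mult_left_mono)
      have "1 * \<kappa> \<le> q * \<kappa>" using q1 \<kappa>(2) by (rule mult_right_mono)
      then have "(N - q * \<kappa>) / 2 ^ Suc s \<le> (N - \<kappa>) / 2 ^ Suc s" by (intro divide_right_mono) auto
      then show "q / 2 * (1 + \<kappa>) + (N - q * \<kappa>) / 2 ^ Suc s \<le> \<kappa> + (N - \<kappa>) / 2 ^ Suc s"
        using \<kappa>(1) by linarith
      show "0 \<le> \<Phi> * (sqrt (card Bs) * L)" using Suc.prems(2) by (simp add: \<Phi>_def)
    qed
    finally show ?case unfolding \<Phi>_def N_def by (rule moves_mono[OF total])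
  qed
qed

end

section \<open>Savings in a slab\<close>

text \<open>
  In the next inequality \<open>\<Delta>\<close> and \<open>q\<close> are the horizontal and the vertical extent of an edge of length
  at most \<open>d\<close>; \<open>M\<close>, \<open>A\<close> and \<open>B\<close> stand for \<open>(a + b) powr \<alpha>\<close>, \<open>a powr \<alpha>\<close> and \<open>b powr \<alpha>\<close>.
\<close>

lemma capped_saving_step:
  fixes A B M \<Delta> d g q G :: real
  assumes "0 \<le> A" "A \<le> M" "0 \<le> B" "B \<le> M" "0 \<le> \<Delta>" "\<Delta> \<le> d" "q \<le> d"
  shows "A * \<Delta> \<le> M * d + B * (max 0 (min (g - q + \<Delta>) G) - max 0 (min g G))"
proof (cases "max 0 (min g G) \<le> max 0 (min (g - q + \<Delta>) G)")
  case True
  have "A * \<Delta> \<le> M * d" using assms by (intro mult_mono) auto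
  moreover have "0 \<le> B * (max 0 (min (g - q + \<Delta>) G) - max 0 (min g G))"
    using True assms(3) by (intro mult_nonneg_nonneg) auto
  ultimately show ?thesis by linarith
next
  case False
  let ?e = "max 0 (min g G) - max 0 (min (g - q + \<Delta>) G)"
  have e: "0 \<le> ?e" "?e \<le> q - \<Delta>" using False by (auto simp: max_def min_def split: if_splits)
  have "A * \<Delta> + B * ?e \<le> M * \<Delta> + M * ?e" using assms e by (intro add_mono mult_right_mono) auto
  also have "\<dots> = M * (\<Delta> + ?e)" by (simp add: distrib_left)
  also have "\<dots> \<le> M * d" using assms e by (intro mult_left_mono) auto
  finally show ?thesis by (simp add: right_diff_distrib)
qed

locale slab = irrigation \<alpha> n y for \<alpha> :: real and n and y :: "nat \<Rightarrow> 'a::euclidean_space" +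
  fixes p v :: 'a and t0 t2 R :: real
  assumes v: "norm v = 1" and t: "t0 < t2" and R: "0 \<le> R"
begin

abbreviation ax :: "'a \<Rightarrow> real" where "ax z \<equiv> axis_coord p v z"

definition raise :: "'a \<Rightarrow> 'a" where "raise z = z + (max t2 (ax z) - ax z) *\<^sub>R v"

definition cylinder :: "'a set" where "cylinder = {z. norm (z - p - ax z *\<^sub>R v) \<le> R}"

definition base :: "'a set" where "base = {z \<in> cylinder. ax z = t0}"

lemma vv: "v \<bullet> v = 1"
  using v by (simp add: dot_square_norm)

lemma convex_cylinder: "convex cylinder"
proof -
  have eq: "z - p - ax z *\<^sub>R v = (z - (z \<bullet> v) *\<^sub>R v) - (p - (p \<bullet> v) *\<^sub>R v)" for z
    by (simp add: axis_coord_def inner_diff_left algebra_simps)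
  have "linear (\<lambda>z. z - (z \<bullet> v) *\<^sub>R v)"
    by (intro linearI) (simp_all add: inner_add_left algebra_simps)
  then have "convex ((\<lambda>z. z - (z \<bullet> v) *\<^sub>R v) -` cball (p - (p \<bullet> v) *\<^sub>R v) R)"
    by (rule convex_linear_vimage) (rule convex_cball)
  also have "(\<lambda>z. z - (z \<bullet> v) *\<^sub>R v) -` cball (p - (p \<bullet> v) *\<^sub>R v) R = cylinder"
    unfolding cylinder_def eq by (auto simp: dist_norm norm_minus_commute)
  finally show ?thesis .
qed

lemma closed_cylinder: "closed cylinder"
  unfolding cylinder_def axis_coord_def by (intro closed_Collect_le continuous_intros)

lemma ax_raise: "ax (raise z) = max t2 (ax z)"
  unfolding raise_def axis_coord_def by (simp add: inner_diff_left inner_add_left vv algebra_simps)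

lemma raise_above: "t2 \<le> ax z \<Longrightarrow> raise z = z"
  by (simp add: raise_def)

lemma raise_dist:
  "(dist (raise a) (raise b))\<^sup>2 + (min (ax a) t2 - min (ax b) t2)\<^sup>2 \<le> (dist a b)\<^sup>2"
proof -
  have perp: "(raise a - raise b) - ((raise a - raise b) \<bullet> v) *\<^sub>R v = (a - b) - ((a - b) \<bullet> v) *\<^sub>R v"
    unfolding raise_def by (simp add: inner_diff_left inner_add_left vv algebra_simps)
  have "(dist a b)\<^sup>2 = (ax a - ax b)\<^sup>2 + (norm ((a - b) - ((a - b) \<bullet> v) *\<^sub>R v))\<^sup>2"
    unfolding dist_norm axis_coord_diff by (rule norm_axis_decomp[OF v])
  moreover have "(dist (raise a) (raise b))\<^sup>2 =
      (max t2 (ax a) - max t2 (ax b))\<^sup>2 + (norm ((a - b) - ((a - b) \<bullet> v) *\<^sub>R v))\<^sup>2"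
  proof -
    have "(raise a - raise b) \<bullet> v = max t2 (ax a) - max t2 (ax b)"
      unfolding axis_coord_diff[symmetric, of _ _ v p] ax_raise ..
    then show ?thesis
      unfolding dist_norm norm_axis_decomp[OF v, of "raise a - raise b"] perp by simp
  qed
  moreover have "(max t2 (ax a) - max t2 (ax b))\<^sup>2 + (min (ax a) t2 - min (ax b) t2)\<^sup>2 \<le> (ax a - ax b)\<^sup>2"
  proof -
    have *: "s\<^sup>2 + r\<^sup>2 \<le> (s + r)\<^sup>2" if "0 \<le> s * r" for s r :: real
      using that by (simp add: power2_sum mult.commute)
    have "0 \<le> (max t2 (ax a) - max t2 (ax b)) * (min (ax a) t2 - min (ax b) t2)"
      by (cases "ax a \<le> ax b") (auto intro!: mult_nonneg_nonneg mult_nonpos_nonpos simp: max_def min_def)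
    note *[OF this]
    also have "(max t2 (ax a) - max t2 (ax b)) + (min (ax a) t2 - min (ax b) t2) = ax a - ax b"
      by (auto simp: max_def min_def)
    finally show ?thesis .
  qed
  ultimately show ?thesis by linarith
qed

lemma cut_level:
  assumes "a \<in> cylinder" "b \<in> cylinder" "t0 < ax a" "ax b \<le> t0"
  shows "\<exists>z\<in>base. dist a z + dist z b = dist a b \<and> ax a - t0 \<le> dist a z"
proof -
  obtain z where z: "z \<in> closed_segment a b" "ax z = t0" "dist a z + dist z b = dist a b"
    using axis_crossing[OF assms(4,3)] by blast
  have "z \<in> cylinder"
    using convex_contains_segment[of cylinder] convex_cylinder assms(1,2) z(1) by blast
  moreover have "ax a - t0 \<le> dist a z" using axis_coord_dist[OF v, of p a z] z(2) by linarith
  ultimately show ?thesis using z unfolding base_def by blast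
qed

lemma tree_cut_steep:
  assumes \<alpha>: "1 \<le> 2 * \<alpha>" and tree: "tree cylinder u A r" and u: "t2 \<le> ax u"
    and atoms: "\<And>h. h \<in> A \<Longrightarrow> ax (y h) \<le> t0 \<or> t2 \<le> ax (y h)"
  shows "\<exists>B r1 r2. B \<subseteq> A \<and> (\<forall>h\<in>A. ax (y h) \<le> t0 \<longrightarrow> h \<in> B) \<and> sourced {u} (A - B) r1 \<and>
           sourced base B r2 \<and> r1 + r2 + mass B powr \<alpha> * (t2 - t0) \<le> r"
proof -
  let ?comp = "\<lambda>c J g. J = {raise c} \<and> g = min (ax c) t2 - t0"
  show ?thesis
  proof (rule tree_cut[OF tree, where lo = t0 and hi = t2 and \<pi> = ax and comp = ?comp and J = "{u}"
        and g = "t2 - t0" and L = base])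
    show "t0 < ax u" using u t by linarith
    show "{u} = {raise u} \<and> t2 - t0 = min (ax u) t2 - t0" using u by (simp add: raise_above)
    show "ax (y h) \<le> t0 \<or> t2 \<le> ax (y h)" if "h \<in> A" for h using atoms that .
    show "\<exists>z\<in>base. dist a z + dist z b = dist a b \<and> ax a - t0 \<le> dist a z"
      if "a \<in> cylinder" "b \<in> cylinder" "t0 < ax a" "ax b \<le> t0" for a b
      using cut_level that .
    show "c \<in> J" if "?comp c J g" "t2 \<le> ax c" for c J g using that by (simp add: raise_above)
    show "0 \<le> g \<and> g \<le> ax c - t0" if "?comp c J g" "t0 < ax c" for c J g using that t by auto
    fix a c J g assume comp: "?comp a J g"
    let ?g' = "min (ax c) t2 - t0"
    have "sourced J A (r + ((mass A + b) powr \<alpha> * dist a c + b powr \<alpha> * (?g' - g)))"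
      if A: "finite A" and b: "0 \<le> b" and src: "sourced {raise c} A r" for A r b
    proof -
      have "sourced {raise a} A (r + mass A powr \<alpha> * dist (raise a) (raise c))"
        by (rule sourced_move[OF src])
      moreover have "mass A powr \<alpha> * dist (raise a) (raise c) + b powr \<alpha> * (min (ax a) t2 - min (ax c) t2)
          \<le> (mass A + b) powr \<alpha> * dist a c"
      proof (rule cauchy_two[OF _ raise_dist])
        have "(mass A powr \<alpha>)\<^sup>2 + (b powr \<alpha>)\<^sup>2 = mass A powr (2 * \<alpha>) + b powr (2 * \<alpha>)"
          by (simp add: power2_eq_square flip: powr_add)
        also have "\<dots> \<le> (mass A + b) powr (2 * \<alpha>)" using \<alpha> b by (intro powr_superadd) auto
        also have "\<dots> = ((mass A + b) powr \<alpha>)\<^sup>2" by (simp add: power2_eq_square flip: powr_add)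
        finally show "(mass A powr \<alpha>)\<^sup>2 + (b powr \<alpha>)\<^sup>2 \<le> ((mass A + b) powr \<alpha>)\<^sup>2" .
      qed auto
      ultimately show ?thesis using comp
        by (elim sourced_mono) (auto simp: algebra_simps)
    qed
    then show "\<exists>J' g'. ?comp c J' g' \<and> (\<forall>A r b. finite A \<longrightarrow> 0 \<le> b \<longrightarrow> sourced J' A r \<longrightarrow>
         sourced J A (r + ((mass A + b) powr \<alpha> * dist a c + b powr \<alpha> * (g' - g))))"
      by blast
  qed
qed

text \<open>
  In the plane the part of the tree that stays above the cut is supplied along the line \<open>\<pi> = t2\<close>. An
  edge loses saving only while it enlarges the interval of horizontal positions visited so far, so
  the total loss is at most the width \<open>2 * R\<close> of the strip.
\<close>

lemma tree_cut_planar: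
  assumes e: "norm e = 1 \<or> e = 0" and coord: "\<And>z. z - p - ax z *\<^sub>R v = ((z - p) \<bullet> e) *\<^sub>R e"
    and tree: "tree cylinder u A r" and u: "u \<in> cylinder" "t2 \<le> ax u"
    and atoms: "\<And>h. h \<in> A \<Longrightarrow> ax (y h) \<le> t0 \<or> t2 \<le> ax (y h)"
  shows "\<exists>B r1 r2. B \<subseteq> A \<and> (\<forall>h\<in>A. ax (y h) \<le> t0 \<longrightarrow> h \<in> B) \<and> sourced {u} (A - B) r1 \<and>
           sourced base B r2 \<and> r1 + r2 + mass B powr \<alpha> * max 0 (t2 - t0 - 2 * R) \<le> r"
proof -
  define s where "s z = (z - p) \<bullet> e" for z
  define q where "q = (\<lambda>\<sigma>. (p + t2 *\<^sub>R v) + \<sigma> *\<^sub>R e)"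
  define G where "G = t2 - t0 - 2 * R"
  have e1: "norm e \<le> 1" using e by auto
  have s_dist: "\<bar>s a - s b\<bar> \<le> dist a b" for a b
  proof -
    have "s a - s b = (a - b) \<bullet> e" by (simp add: s_def inner_diff_left)
    then have "\<bar>s a - s b\<bar> \<le> dist a b * norm e" using Cauchy_Schwarz_ineq2[of "a - b" e] by (simp add: dist_norm)
    also have "\<dots> \<le> dist a b" using e1 by (simp add: mult_left_le)
    finally show ?thesis .
  qed
  have s_bound: "- R \<le> s z \<and> s z \<le> R" if "z \<in> cylinder" for z
  proof -
    have "\<bar>s z\<bar> * norm e \<le> R" using that unfolding cylinder_def coord s_def by simp
    then show ?thesis using e R by (auto simp: s_def)
  qed
  have raise_q: "raise z = q (s z)" if "ax z \<le> t2" for z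
  proof -
    have "raise z = (z - p - ax z *\<^sub>R v) + (p + t2 *\<^sub>R v)"
      using that by (simp add: raise_def algebra_simps)
    then show ?thesis unfolding coord q_def s_def by (simp add: add.commute)
  qed
  have slab_step: "sourced (q ` {l..r}) A (\<rho> + ((mass A + b) powr \<alpha> * dist a c + b powr \<alpha> *
        (max 0 (min (ax c - t0 - 2 * R + (max r (s c) - min l (s c))) G) -
         max 0 (min (ax a - t0 - 2 * R + (r - l)) G))))"
    if "l \<le> s a" "s a \<le> r" "finite A" "0 \<le> b" "sourced (q ` {min l (s c)..max r (s c)}) A \<rho>"
    for a c l r A b \<rho>
  proof -
    let ?l = "min l (s c)" and ?r = "max r (s c)"
    let ?\<Delta> = "(?r - r) + (l - ?l)"
    have src: "sourced (q ` {l..r}) A (\<rho> + mass A powr \<alpha> * ?\<Delta>)"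
      unfolding q_def using that by (intro sourced_line_shrink[OF e1]) (auto simp: q_def)
    have bound: "mass A powr \<alpha> * ?\<Delta> \<le> (mass A + b) powr \<alpha> * dist a c + b powr \<alpha> *
        (max 0 (min ((ax a - t0 - 2 * R + (r - l)) - (ax a - ax c) + ?\<Delta>) G) -
         max 0 (min (ax a - t0 - 2 * R + (r - l)) G))"
    proof (rule capped_saving_step)
      show "mass A powr \<alpha> \<le> (mass A + b) powr \<alpha>" "b powr \<alpha> \<le> (mass A + b) powr \<alpha>"
        using alpha that(4) by (auto intro!: powr_mono2)
      show "?\<Delta> \<le> dist a c" using s_dist[of a c] that(1,2) by (auto simp: min_def max_def)
      show "ax a - ax c \<le> dist a c" using axis_coord_dist[OF v, of p a c] by linarith
    qed auto
    have eq: "(ax a - t0 - 2 * R + (r - l)) - (ax a - ax c) + ?\<Delta> = ax c - t0 - 2 * R + (?r - ?l)"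
      by simp
    show ?thesis by (rule sourced_mono[OF src subset_refl]) (use bound[unfolded eq] in linarith)
  qed
  define comp where "comp c J g \<longleftrightarrow> (\<exists>l r. - R \<le> l \<and> l \<le> s c \<and> s c \<le> r \<and> r \<le> R \<and>
      (if t2 \<le> ax c then l = r \<and> J = {c} else J = q ` {l..r}) \<and>
      g = max 0 (min (ax c - t0 - 2 * R + (r - l)) G))" for c J g
  have comp_top: "comp c {c} (max 0 G)" if "c \<in> cylinder" "t2 \<le> ax c" for c
    unfolding comp_def using s_bound[OF that(1)] that(2)
    by (intro exI[of _ "s c"]) (simp add: G_def)
  show ?thesis unfolding G_def[symmetric]
  proof (rule tree_cut[OF tree, where lo = t0 and hi = t2 and \<pi> = ax and comp = comp and J = "{u}"
        and g = "max 0 G" and L = base])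
    show "t0 < ax u" using u t by linarith
    show "comp u {u} (max 0 G)" using comp_top u .
    show "ax (y h) \<le> t0 \<or> t2 \<le> ax (y h)" if "h \<in> A" for h using atoms that .
    show "\<exists>z\<in>base. dist a z + dist z b = dist a b \<and> ax a - t0 \<le> dist a z"
      if "a \<in> cylinder" "b \<in> cylinder" "t0 < ax a" "ax b \<le> t0" for a b
      using cut_level that .
    show "c \<in> J" if "comp c J g" "t2 \<le> ax c" for c J g using that by (auto simp: comp_def)
    show "0 \<le> g \<and> g \<le> ax c - t0" if "comp c J g" "t0 < ax c" for c J g
      using that by (auto simp: comp_def)
  next
    fix a c J g
    assume ac: "a \<in> cylinder" "c \<in> cylinder" "t0 < ax a" "t0 < ax c" and comp: "comp a J g"
    obtain l r where lr: "- R \<le> l" "l \<le> s a" "s a \<le> r" "r \<le> R"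
      "if t2 \<le> ax a then l = r \<and> J = {a} else J = q ` {l..r}"
      "g = max 0 (min (ax a - t0 - 2 * R + (r - l)) G)"
      using comp unfolding comp_def by blast
    show "\<exists>J' g'. comp c J' g' \<and> (\<forall>A r b. finite A \<longrightarrow> 0 \<le> b \<longrightarrow> sourced J' A r \<longrightarrow>
         sourced J A (r + ((mass A + b) powr \<alpha> * dist a c + b powr \<alpha> * (g' - g))))"
    proof (cases "t2 \<le> ax c")
      case True
      have "sourced J A (\<rho> + ((mass A + b) powr \<alpha> * dist a c + b powr \<alpha> * (max 0 G - g)))"
        if A: "finite A" "0 \<le> b" "sourced {c} A \<rho>" for A \<rho> b
      proof -
        have "\<exists>a'\<in>J. dist a' c \<le> dist a c"
        proof (cases "t2 \<le> ax a")
          case True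
          then show ?thesis using lr(5) by auto
        next
          case False
          have "dist (raise a) (raise c) \<le> dist a c"
          proof (rule power2_le_imp_le)
            show "(dist (raise a) (raise c))\<^sup>2 \<le> (dist a c)\<^sup>2"
              using raise_dist[of a c] zero_le_power2[of "min (ax a) t2 - min (ax c) t2"] by linarith
          qed simp
          then show ?thesis using False lr raise_q[of a] raise_above[OF True] by auto
        qed
        then obtain a' where a': "a' \<in> J" "dist a' c \<le> dist a c" by blast
        have "mass A powr \<alpha> * dist a' c \<le> (mass A + b) powr \<alpha> * dist a c"
          using alpha A(2) a'(2) by (intro mult_mono powr_mono2) auto
        moreover have "0 \<le> b powr \<alpha> * (max 0 G - g)"
          using lr(6) by (intro mult_nonneg_nonneg) auto
        ultimately have "\<rho> + mass A powr \<alpha> * dist a' c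
            \<le> \<rho> + ((mass A + b) powr \<alpha> * dist a c + b powr \<alpha> * (max 0 G - g))" by linarith
        then show ?thesis by (rule sourced_mono[OF sourced_move[OF A(3), of a'], rotated]) (use a' in auto)
      qed
      then show ?thesis using comp_top[OF ac(2) True] by blast
    next
      case c: False
      show ?thesis
      proof (cases "t2 \<le> ax a")
        case False
        let ?l = "min l (s c)" and ?r = "max r (s c)"
        have "comp c (q ` {?l..?r}) (max 0 (min (ax c - t0 - 2 * R + (?r - ?l)) G))"
          unfolding comp_def using c lr s_bound[OF ac(2)]
          by (intro exI[of _ ?l] exI[of _ ?r]) (simp add: min_def max_def)
        moreover have "J = q ` {l..r}" using lr(5) False by simp
        ultimately show ?thesis using slab_step[OF lr(2,3)] unfolding lr(6) by blast
      next
        case True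
        then have J: "J = {a}" "g = max 0 G" using lr by (auto simp: G_def)
        obtain m where m: "m \<in> closed_segment a c" "ax m = t2" "dist a m + dist m c = dist a c"
        proof (cases "ax a = t2")
          case True
          then show ?thesis using that[of a] by simp
        next
          case False
          then show ?thesis using axis_crossing[of p v c t2 a] c True that by force
        qed
        have mc: "m \<in> cylinder"
          using convex_contains_segment[of cylinder] convex_cylinder ac(1,2) m(1) by blast
        let ?l = "min (s m) (s c)" and ?r = "max (s m) (s c)"
        let ?g = "max 0 (min (ax c - t0 - 2 * R + (?r - ?l)) G)"
        have comp': "comp c (q ` {?l..?r}) ?g"
          unfolding comp_def using c s_bound[OF ac(2)] s_bound[OF mc]
          by (intro exI[of _ ?l] exI[of _ ?r]) (simp add: min_def max_def)
        have "sourced J A (\<rho> + ((mass A + b) powr \<alpha> * dist a c + b powr \<alpha> * (?g - g)))"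
          if A: "finite A" "0 \<le> b" "sourced (q ` {?l..?r}) A \<rho>" for A \<rho> b
        proof -
          have qm: "q (s m) = m" using raise_q[of m] raise_above[of m] m(2) by simp
          have mG: "min (ax m - t0 - 2 * R + (s m - s m)) G = G" using m(2) by (simp add: G_def)
          have "sourced (q ` {s m..s m}) A (\<rho> + ((mass A + b) powr \<alpha> * dist m c + b powr \<alpha> * (?g - max 0 G)))"
            using slab_step[of "s m" m "s m" A b c \<rho>] A unfolding mG by simp
          then have "sourced {m} A (\<rho> + ((mass A + b) powr \<alpha> * dist m c + b powr \<alpha> * (?g - max 0 G)))"
            using qm by simp
          note sourced_move[OF this, of a]
          moreover have "mass A powr \<alpha> * dist a m \<le> (mass A + b) powr \<alpha> * dist a m"
            using alpha A(2) by (intro mult_right_mono powr_mono2) auto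
          moreover have "(mass A + b) powr \<alpha> * dist a c =
              (mass A + b) powr \<alpha> * dist a m + (mass A + b) powr \<alpha> * dist m c"
            unfolding m(3)[symmetric] by (rule distrib_left)
          ultimately show ?thesis unfolding J by (elim sourced_mono) auto
        qed
        then show ?thesis using comp' by blast
      qed
    qed
  qed
qed

lemma perp_basis:
  obtains Bs where "finite Bs" "pairwise orthogonal Bs" "\<And>e. e \<in> Bs \<Longrightarrow> norm e = 1"
    "card Bs = DIM('a) - 1"
    "\<And>z. z - p - ax z *\<^sub>R v = (\<Sum>e\<in>Bs. ((z - p) \<bullet> e) *\<^sub>R e)"
proof -
  obtain Bs where Bs: "Bs \<subseteq> {w. v \<bullet> w = 0}" "pairwise orthogonal Bs" "\<And>e. e \<in> Bs \<Longrightarrow> norm e = 1"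
    "independent Bs" "card Bs = dim {w. v \<bullet> w = 0}" "span Bs = {w. v \<bullet> w = 0}"
    using orthonormal_basis_subspace[OF subspace_hyperplane[of v]] by metis
  have fin: "finite Bs" using Bs(4) by (rule independent_imp_finite)
  have "v \<noteq> 0" using v by auto
  then have "card Bs = DIM('a) - 1" using Bs(5) by (simp add: dim_hyperplane)
  moreover have "z - p - ax z *\<^sub>R v = (\<Sum>e\<in>Bs. ((z - p) \<bullet> e) *\<^sub>R e)" for z
  proof -
    let ?w = "z - p - ax z *\<^sub>R v"
    have "v \<bullet> ?w = 0" by (simp add: axis_coord_def inner_diff_right inner_diff_left vv inner_commute)
    then have "?w \<in> span Bs" using Bs(6) by simp
    then have "?w = (\<Sum>e\<in>Bs. (?w \<bullet> e) *\<^sub>R e)"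
      using orthonormal_basis_expand[OF Bs(2,3) _ fin, of ?w] by simp
    also have "\<dots> = (\<Sum>e\<in>Bs. ((z - p) \<bullet> e) *\<^sub>R e)"
    proof (rule sum.cong)
      fix e assume "e \<in> Bs"
      then have "v \<bullet> e = 0" using Bs(1) by auto
      then show "(?w \<bullet> e) *\<^sub>R e = ((z - p) \<bullet> e) *\<^sub>R e" by (simp add: inner_diff_left)
    qed simp
    finally show ?thesis .
  qed
  ultimately show thesis using that fin Bs(2,3) by blast
qed

lemma base_irrigation_dyadic:
  assumes d: "d = real (DIM('a) - 1)" "d * (1 - \<alpha>) < 1"
    and \<kappa>: "\<kappa> = 1 / (2 powr (1 - d * (1 - \<alpha>)) - 1)"
    and xs: "xs \<in> cylinder" and B: "finite B" "z ` B \<subseteq> base" and W: "sqrt d * R * \<kappa> < W"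
  shows "moves (\<lambda>_. xs) z B (mass B powr \<alpha> * (\<bar>ax xs - t0\<bar> + (R + W)))"
proof -
  obtain Bs where Bs: "finite Bs" "pairwise orthogonal Bs" "\<And>e. e \<in> Bs \<Longrightarrow> norm e = 1"
    "card Bs = DIM('a) - 1" and expand: "\<And>z. z - p - ax z *\<^sub>R v = (\<Sum>e\<in>Bs. ((z - p) \<bullet> e) *\<^sub>R e)"
    using perp_basis by metis
  define q where "q = 2 powr (d * (1 - \<alpha>))"
  have q: "0 < q" "q < 2" using d(2) powr_less_mono[of "d * (1 - \<alpha>)" 1 2] by (auto simp: q_def)
  have \<kappa>q: "\<kappa> = q / (2 - q)" unfolding \<kappa> powr_diff q_def[symmetric] using q by (simp add: field_simps)
  have \<kappa>0: "0 \<le> \<kappa>" unfolding \<kappa>q using q by simp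
  have \<kappa>eq: "\<kappa> = q / 2 * (1 + \<kappa>)" using q \<kappa>q by (simp add: field_simps)
  let ?o = "p + t0 *\<^sub>R v"
  let ?c = "\<lambda>h e. (z h - p) \<bullet> e"
  have zb: "z h \<in> base" if "h \<in> B" for h using B(2) that by auto
  define X where "X = sqrt d * R * (real (card B) - \<kappa>)"
  obtain s where s: "X / (W - sqrt d * R * \<kappa>) < 2 ^ s"
    using real_arch_pow[of 2 "X / (W - sqrt d * R * \<kappa>)"] by auto
  have small: "X / 2 ^ s \<le> W - sqrt d * R * \<kappa>"
  proof -
    have "X < 2 ^ s * (W - sqrt d * R * \<kappa>)" using s W by (simp add: pos_divide_less_eq)
    then show ?thesis by (simp add: pos_divide_le_eq mult.commute)
  qed
  have "moves (\<lambda>_. ?o) (\<lambda>h. ?o + (\<Sum>e\<in>Bs. ?c h e *\<^sub>R e)) B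
      (mass B powr \<alpha> * (sqrt (card Bs) * R) * (\<kappa> + (real (card B) - \<kappa>) / 2 ^ s))"
  proof (rule dyadic_irrigation[OF Bs(1-3) _ \<kappa>eq \<kappa>0 B(1) R])
    show "q = 2 powr (real (card Bs) * (1 - \<alpha>))" using d(1) Bs(4) by (simp add: q_def)
    fix h e assume he: "h \<in> B" "e \<in> Bs"
    have "(\<Sum>e'\<in>Bs. ?c h e' *\<^sub>R e') \<bullet> e = (\<Sum>e'\<in>Bs. if e' = e then ?c h e else 0)"
      unfolding inner_sum_left
    proof (rule sum.cong)
      fix e' assume "e' \<in> Bs"
      then show "(?c h e' *\<^sub>R e') \<bullet> e = (if e' = e then ?c h e else 0)"
        using Bs(2,3) he(2) by (auto simp: pairwise_def orthogonal_def dot_square_norm)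
    qed simp
    then have "?c h e = (z h - p - ax (z h) *\<^sub>R v) \<bullet> e" using Bs(1) he(2) by (simp add: expand)
    also have "\<bar>\<dots>\<bar> \<le> norm (z h - p - ax (z h) *\<^sub>R v) * norm e" by (rule Cauchy_Schwarz_ineq2)
    also have "\<dots> \<le> R" using zb[OF he(1)] Bs(3)[OF he(2)] by (auto simp: base_def cylinder_def)
    finally show "\<bar>?c h e\<bar> \<le> R" .
  qed
  then have 2: "moves (\<lambda>_. ?o) z B (mass B powr \<alpha> * W)"
  proof (rule moves_congI)
    fix h assume "h \<in> B"
    then have "ax (z h) = t0" using zb by (auto simp: base_def)
    then show "?o + (\<Sum>e\<in>Bs. ?c h e *\<^sub>R e) = z h" using expand[of "z h"] by (simp add: algebra_simps)
  next
    have "sqrt d * R * (\<kappa> + (real (card B) - \<kappa>) / 2 ^ s) \<le> W"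
      using small by (simp add: X_def distrib_left)
    then have "mass B powr \<alpha> * (sqrt d * R * (\<kappa> + (real (card B) - \<kappa>) / 2 ^ s)) \<le> mass B powr \<alpha> * W"
      by (rule mult_left_mono) simp
    then show "mass B powr \<alpha> * (sqrt (card Bs) * R) * (\<kappa> + (real (card B) - \<kappa>) / 2 ^ s) \<le> mass B powr \<alpha> * W"
      using d(1) Bs(4) by (simp add: mult.assoc)
  qed simp
  have "dist xs ?o = norm ((ax xs - t0) *\<^sub>R v + (xs - p - ax xs *\<^sub>R v))"
    by (simp add: dist_norm algebra_simps)
  also have "\<dots> \<le> \<bar>ax xs - t0\<bar> + R"
    using norm_triangle_ineq[of "(ax xs - t0) *\<^sub>R v" "xs - p - ax xs *\<^sub>R v"] xs v
    by (simp add: cylinder_def)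
  finally have "moves (\<lambda>_. xs) (\<lambda>_. ?o) B (mass B powr \<alpha> * (\<bar>ax xs - t0\<bar> + R))"
    by (intro moves_mono[OF moves_const] mult_left_mono) auto
  from moves_trans[OF this 2] show ?thesis by (simp add: algebra_simps)
qed

lemma base_irrigation_planar:
  assumes e: "norm e = 1 \<or> e = 0" and coord: "\<And>z. z - p - ax z *\<^sub>R v = ((z - p) \<bullet> e) *\<^sub>R e"
    and xs: "xs \<in> cylinder" and B: "finite B" "z ` B \<subseteq> base"
  shows "moves (\<lambda>_. xs) z B (mass B powr \<alpha> * (\<bar>ax xs - t0\<bar> + 2 * R))"
proof -
  define s where "s w = (w - p) \<bullet> e" for w
  let ?o = "p + t0 *\<^sub>R v"
  have s_bound: "- R \<le> s w \<and> s w \<le> R" if "w \<in> cylinder" for w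
  proof -
    have "\<bar>s w\<bar> * norm e \<le> R" using that unfolding cylinder_def coord s_def by simp
    then show ?thesis using e R by (auto simp: s_def)
  qed
  have zb: "z h \<in> base" if "h \<in> B" for h using B(2) that by auto
  have "moves (\<lambda>h. ?o + max (s xs) (min (s xs) (s (z h))) *\<^sub>R e) (\<lambda>h. ?o + s (z h) *\<^sub>R e) B
           (mass B powr \<alpha> * ((R - s xs) + (s xs - (- R))))"
    using s_bound[OF xs] s_bound zb e B(1) by (intro line_clamp) (auto simp: base_def)
  then have 2: "moves (\<lambda>_. ?o + s xs *\<^sub>R e) z B (mass B powr \<alpha> * (2 * R))"
  proof (rule moves_congI)
    fix h assume "h \<in> B"
    then have "ax (z h) = t0" using zb by (auto simp: base_def)
    then show "?o + s (z h) *\<^sub>R e = z h" using coord[of "z h"] by (simp add: s_def algebra_simps)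
  qed auto
  have "xs - (?o + s xs *\<^sub>R e) = (xs - p - ax xs *\<^sub>R v) - s xs *\<^sub>R e + (ax xs - t0) *\<^sub>R v"
    by (simp add: algebra_simps)
  also have "\<dots> = (ax xs - t0) *\<^sub>R v" unfolding coord s_def by simp
  finally have "dist xs (?o + s xs *\<^sub>R e) = \<bar>ax xs - t0\<bar>" using v by (simp add: dist_norm)
  then have "moves (\<lambda>_. xs) (\<lambda>_. ?o + s xs *\<^sub>R e) B (mass B powr \<alpha> * \<bar>ax xs - t0\<bar>)"
    using moves_const[of xs "?o + s xs *\<^sub>R e" B] by simp
  from moves_trans[OF this 2] show ?thesis by (simp add: algebra_simps)
qed

end

section \<open>Reassignment\<close>

lemma C_const_eq: "C_const \<alpha> DIM('a::euclidean_space) = sqrt (real (DIM('a) - 1)) * (1 / (2 powr (1 - real (DIM('a) - 1) * (1 - \<alpha>)) - 1)) + 1"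
  unfolding C_const_def by (simp add: of_nat_diff Suc_leI)

context irrigation
begin

lemma a_part_masses: "a_part l x n S i = masses (preim l S i) (\<lambda>_. x i)"
  by (simp add: a_part_def masses_const)

lemma b_part_masses: "b_part l y n S i = masses (preim l S i) y"
  by (simp add: b_part_def masses_def)

lemma finite_preim [simp]: "finite (preim l S i)"
  by (simp add: preim_def)

lemma moves_d_alpha_le:
  "moves (\<lambda>_. x i) y (preim l S i) r \<Longrightarrow> d_alpha \<alpha> (a_part l x n S i) (b_part l y n S i) \<le> r"
  unfolding moves_def a_part_masses b_part_masses using carries_d_alpha_le alpha(1) by blast

lemma d_alpha_less_path:
  assumes "d_alpha \<alpha> (a_part l x n S i) (b_part l y n S i) < r"
  shows "\<exists>V E w. transport_path (masses (preim l S i) (\<lambda>_. x i)) (masses (preim l S i) y) V E w \<and> M_alpha \<alpha> E w < r"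
  using moves_exists[of "preim l S i" "\<lambda>_. x i" y] assms d_alpha_less_transport_path[OF alpha(1)]
  unfolding moves_def a_part_masses b_part_masses by auto

lemma d_alpha_less_tree:
  assumes "d_alpha \<alpha> (a_part l x n S i) (b_part l y n S i) < r"
  shows "tree UNIV (x i) (preim l S i) r"
proof -
  obtain V E w where w: "transport_path (masses (preim l S i) (\<lambda>_. x i)) (masses (preim l S i) y) V E w"
    "M_alpha \<alpha> E w < r"
    using d_alpha_less_path[OF assms] by blast
  have "tree UNIV (x i) (preim l S i) (M_alpha \<alpha> E w)" by (rule transport_path_tree[OF _ w(1)]) simp
  then show ?thesis by (rule tree.edge[where v = "x i"]) (use w(2) in auto)
qed

text \<open>
  Handing the atoms \<open>B\<close> over from \<open>i\<close> to \<open>i'\<close> keeps the part of the tree above the cut at \<open>i\<close>, moves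
  the part below it to \<open>i'\<close>, and trades the saving of the slab for the connection from \<open>x i'\<close> to
  the base.
\<close>

lemma reassign_not_cheaper:
  assumes opt: "optimal_assignment \<alpha> k l x y n S"
    and i: "i \<in> {1..k}" "i' \<in> {1..k}" "i \<noteq> i'" and B: "B \<subseteq> preim l S i"
    and r1: "moves (\<lambda>_. x i) y (preim l S i - B) r1" and r2: "moves (\<lambda>_. x i') y B r2"
    and \<epsilon>: "0 < \<epsilon>"
  shows "d_alpha \<alpha> (a_part l x n S i) (b_part l y n S i) \<le> r1 + r2 + \<epsilon>"
proof -
  let ?d = "\<lambda>S m. d_alpha \<alpha> (a_part l x n S m) (b_part l y n S m)"
  define S' where "S' = (\<lambda>h. if h \<in> B then i' else S h)"
  have S: "S \<in> assign_maps l k" and min: "\<And>T. T \<in> assign_maps l k \<Longrightarrow> \<not> E_alpha \<alpha> k l x y n T < E_alpha \<alpha> k l x y n S"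
    using opt unfolding optimal_assignment_def is_arg_min_def by auto
  have Bl: "B \<subseteq> {1..l}" using B by (auto simp: preim_def)
  have "S' \<in> assign_maps l k"
    using S Bl i(2) unfolding assign_maps_def S'_def PiE_def extensional_def by auto
  then have le: "E_alpha \<alpha> k l x y n S \<le> E_alpha \<alpha> k l x y n S'" using min by fastforce
  have pi: "preim l S' i = preim l S i - B" using B i(3) by (auto simp: preim_def S'_def)
  have pi': "preim l S' i' = preim l S i' \<union> B" using B i(3) Bl by (auto simp: preim_def S'_def)
  have po: "preim l S' m = preim l S m" if "m \<noteq> i" "m \<noteq> i'" for m
    using B that by (auto simp: preim_def S'_def)
  have split: "E_alpha \<alpha> k l x y n T = ?d T i + (?d T i' + (\<Sum>m\<in>{1..k} - {i} - {i'}. ?d T m))" for T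
    unfolding E_alpha_def using i by (subst sum.remove[of _ i], simp_all, subst sum.remove[of _ i'], simp_all)
  have rest: "(\<Sum>m\<in>{1..k} - {i} - {i'}. ?d S' m) = (\<Sum>m\<in>{1..k} - {i} - {i'}. ?d S m)"
    by (intro sum.cong) (auto simp: a_part_def b_part_def po)
  have "moves (\<lambda>_. x i) y (preim l S' i) r1" unfolding pi by (rule r1)
  then have d1: "?d S' i \<le> r1" by (rule moves_d_alpha_le)
  have "tree UNIV (x i') (preim l S i') (?d S i' + \<epsilon>)" using \<epsilon> by (intro d_alpha_less_tree) simp
  then have "moves (\<lambda>_. x i') y (preim l S i') (?d S i' + \<epsilon>)" by (rule tree_moves)
  then have "moves (\<lambda>_. x i') y (preim l S i' \<union> B) (?d S i' + \<epsilon> + r2)"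
    using r2 B i(3) finite_subset[OF B] by (intro moves_union) (auto simp: preim_def)
  then have "moves (\<lambda>_. x i') y (preim l S' i') (?d S i' + \<epsilon> + r2)" unfolding pi' .
  then have d2: "?d S' i' \<le> ?d S i' + \<epsilon> + r2" by (rule moves_d_alpha_le)
  show ?thesis using le d1 d2 unfolding split[of S] split[of S'] rest by linarith
qed

lemma optimal_gap_le:
  assumes C_finite: "(real DIM('a) - 1) * (1 - \<alpha>) < 1"
    and v: "norm v = 1" and opt: "optimal_assignment \<alpha> k l x y n S"
    and i: "i \<in> {1..k}" "i' \<in> {1..k}" "i \<noteq> i'" and j: "j \<in> preim l S i"
    and lev: "axis_coord p v (y j) = t0" "t0 < t2" "t2 \<le> axis_coord p v (x i)"
    and atoms: "\<And>h. h \<in> preim l S i \<Longrightarrow> axis_coord p v (y h) \<le> t0 \<or> t2 \<le> axis_coord p v (y h)"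
  shows "t2 - t0 \<le> 2 * C_const \<alpha> DIM('a) * R_max p v k l x y S i + \<bar>axis_coord p v (x i') - t0\<bar>"
proof (rule ccontr)
  define R where "R = R_max p v k l x y S i"
  define D where "D = t2 - t0 - \<bar>axis_coord p v (x i') - t0\<bar>"
  define d where "d = real (DIM('a) - 1)"
  define \<kappa> where "\<kappa> = 1 / (2 powr (1 - d * (1 - \<alpha>)) - 1)"
  let ?H = "preim l S i"
  assume "\<not> ?thesis"
  then have gap: "2 * (sqrt d * \<kappa> + 1) * R < D"
    unfolding D_def R_def d_def \<kappa>_def C_const_eq by simp
  have dim: "d = real DIM('a) - 1" by (simp add: d_def of_nat_diff Suc_leI)
  have d1: "d * (1 - \<alpha>) < 1" using C_finite dim by simp
  then have \<kappa>0: "0 < \<kappa>" unfolding \<kappa>_def by (simp add: gr_one_powr)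
  let ?N = "\<lambda>z. norm (z - p - axis_coord p v z *\<^sub>R v)"
  have le_R: "?N z \<le> R" if "z \<in> y ` ?H \<union> x ` {1..k}" for z
    unfolding R_def R_max_def using that by (intro Max_ge) auto
  have "0 \<le> ?N (x i)" by simp
  also have "\<dots> \<le> R" using i by (intro le_R) auto
  finally have R0: "0 \<le> R" .
  interpret slab \<alpha> n y p v t0 t2 R by unfold_locales (use v lev R0 in auto)
  have cyl: "y h \<in> cylinder" if "h \<in> ?H" for h using le_R that by (auto simp: cylinder_def)
  have cylx: "x m \<in> cylinder" if "m \<in> {1..k}" for m using le_R that by (auto simp: cylinder_def)
  obtain G W where GW: "\<bar>ax (x i') - t0\<bar> + W < G"
    and cut: "\<And>r. tree cylinder (x i) ?H r \<Longrightarrow>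
      \<exists>B r1 r2. B \<subseteq> ?H \<and> (\<forall>h\<in>?H. ax (y h) \<le> t0 \<longrightarrow> h \<in> B) \<and> sourced {x i} (?H - B) r1 \<and>
           sourced base B r2 \<and> r1 + r2 + mass B powr \<alpha> * G \<le> r"
    and irr: "\<And>B z. finite B \<Longrightarrow> z ` B \<subseteq> base \<Longrightarrow>
      moves (\<lambda>_. x i') z B (mass B powr \<alpha> * (\<bar>ax (x i') - t0\<bar> + W))"
  proof (cases "DIM('a) \<le> 2")
    case True
    obtain Bs where Bs: "finite Bs" "\<And>e. e \<in> Bs \<Longrightarrow> norm e = 1" "card Bs = DIM('a) - 1"
      and expand: "\<And>z. z - p - ax z *\<^sub>R v = (\<Sum>e\<in>Bs. ((z - p) \<bullet> e) *\<^sub>R e)"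
      using perp_basis by metis
    obtain e where e: "norm e = 1 \<or> e = 0" "\<And>z. z - p - ax z *\<^sub>R v = ((z - p) \<bullet> e) *\<^sub>R e"
      and e0: "DIM('a) = 1 \<Longrightarrow> e = 0"
    proof (cases "Bs = {}")
      case True
      then show ?thesis using that[of 0] expand by simp
    next
      case False
      have "card Bs \<le> 1" "card Bs \<noteq> 0" using Bs(1,3) True False by auto
      then have "card Bs = 1" by linarith
      then obtain e where "Bs = {e}" by (rule card_1_singletonE)
      then show ?thesis using that[of e] expand Bs(2,3) by simp
    qed
    have R4: "4 * R \<le> 2 * (sqrt d * \<kappa> + 1) * R"
    proof (cases "DIM('a) = 1")
      case True
      have "y ` ?H \<union> x ` {1..k} \<noteq> {}" using i by auto
      then have "R \<in> ?N ` (y ` ?H \<union> x ` {1..k})" unfolding R_def R_max_def by (intro Max_in) auto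
      then have "R = 0" using e(2) e0[OF True] by auto
      then show ?thesis by simp
    next
      case False
      then have "DIM('a) = 2" using True DIM_positive[where 'a = 'a] by linarith
      then have "d = 1" by (simp add: d_def)
      have "2 powr (1 - d * (1 - \<alpha>)) \<le> 2 powr 1" using alpha by (intro powr_mono) (auto simp: \<open>d = 1\<close>)
      moreover have "1 < 2 powr (1 - d * (1 - \<alpha>))" using d1 by (simp add: gr_one_powr)
      ultimately have "1 \<le> \<kappa>" unfolding \<kappa>_def by (simp add: field_simps)
      then have "2 * 2 * R \<le> 2 * (sqrt d * \<kappa> + 1) * R"
        using \<open>d = 1\<close> R0 by (intro mult_right_mono) auto
      then show ?thesis by simp
    qed
    show ?thesis
    proof (rule that[of "2 * R" "max 0 (t2 - t0 - 2 * R)"])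
      show "\<bar>ax (x i') - t0\<bar> + 2 * R < max 0 (t2 - t0 - 2 * R)" using gap R4 unfolding D_def by linarith
      show "moves (\<lambda>_. x i') z B (mass B powr \<alpha> * (\<bar>ax (x i') - t0\<bar> + 2 * R))"
        if "finite B" "z ` B \<subseteq> base" for B z
        by (rule base_irrigation_planar[OF e cylx[OF i(2)] that])
    next
      fix r assume tr: "tree cylinder (x i) ?H r"
      show "\<exists>B r1 r2. B \<subseteq> ?H \<and> (\<forall>h\<in>?H. ax (y h) \<le> t0 \<longrightarrow> h \<in> B) \<and> sourced {x i} (?H - B) r1 \<and>
           sourced base B r2 \<and> r1 + r2 + mass B powr \<alpha> * max 0 (t2 - t0 - 2 * R) \<le> r"
        by (rule tree_cut_planar[OF e tr cylx[OF i(1)] lev(3) atoms])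
    qed
  next
    case False
    then have "2 \<le> d" by (simp add: d_def)
    then have "2 * (1 - \<alpha>) \<le> d * (1 - \<alpha>)" using alpha by (intro mult_right_mono) auto
    from le_less_trans[OF this d1] have \<alpha>2: "1 \<le> 2 * \<alpha>" by simp
    define W where "W = (D - 2 * (sqrt d * \<kappa> + 1) * R) / 2 + sqrt d * R * \<kappa>"
    have nn: "0 \<le> sqrt d * R * \<kappa>" using R0 \<kappa>0 by (simp add: d_def)
    have W1: "sqrt d * R * \<kappa> < W" using gap by (simp add: W_def)
    have exp: "2 * (sqrt d * \<kappa> + 1) * R = 2 * (sqrt d * R * \<kappa>) + 2 * R" by (simp add: algebra_simps)
    have "R + ((D - (2 * Y + 2 * R)) / 2 + Y) < D" if "2 * Y + 2 * R < D" "0 \<le> Y" for Y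
      using that R0 by (simp add: field_simps)
    then have W2: "R + W < D" using gap nn unfolding W_def exp by blast
    show ?thesis
    proof (rule that[of "R + W" "t2 - t0"])
      show "\<bar>ax (x i') - t0\<bar> + (R + W) < t2 - t0" using W2 unfolding D_def by linarith
      show "moves (\<lambda>_. x i') z B (mass B powr \<alpha> * (\<bar>ax (x i') - t0\<bar> + (R + W)))"
        if "finite B" "z ` B \<subseteq> base" for B z
        by (rule base_irrigation_dyadic[OF d_def d1 \<kappa>_def cylx[OF i(2)] that W1])
    next
      fix r assume tr: "tree cylinder (x i) ?H r"
      show "\<exists>B r1 r2. B \<subseteq> ?H \<and> (\<forall>h\<in>?H. ax (y h) \<le> t0 \<longrightarrow> h \<in> B) \<and> sourced {x i} (?H - B) r1 \<and>
           sourced base B r2 \<and> r1 + r2 + mass B powr \<alpha> * (t2 - t0) \<le> r"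
        by (rule tree_cut_steep[OF \<alpha>2 tr lev(3) atoms])
    qed
  qed
  let ?c = "\<bar>ax (x i') - t0\<bar> + W" and ?di = "d_alpha \<alpha> (a_part l x n S i) (b_part l y n S i)"
  define \<epsilon> where "\<epsilon> = n j powr \<alpha> * (G - ?c) / 4"
  have nj: "0 < n j powr \<alpha>" using n_pos[of j] by simp
  have \<epsilon>: "0 < \<epsilon>" using GW nj by (simp add: \<epsilon>_def)
  have ne: "cylinder \<noteq> {}" using cylx i(1) by blast
  have "tree UNIV (x i) ?H (?di + \<epsilon>)" using \<epsilon> by (intro d_alpha_less_tree) simp
  then have "tree cylinder (closest_point cylinder (x i)) ?H (?di + \<epsilon>)"
    by (rule tree_retract)
      (use cyl ne convex_cylinder closed_cylinder in
        \<open>auto intro: closest_point_self closest_point_in_set closest_point_lipschitz\<close>)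
  then have "tree cylinder (x i) ?H (?di + \<epsilon>)" by (simp add: closest_point_self cylx[OF i(1)])
  from cut[OF this] obtain B r1 r2 where B: "B \<subseteq> ?H" "\<forall>h\<in>?H. ax (y h) \<le> t0 \<longrightarrow> h \<in> B"
    "sourced {x i} (?H - B) r1" "sourced base B r2" "r1 + r2 + mass B powr \<alpha> * G \<le> ?di + \<epsilon>" by blast
  have finB: "finite B" by (rule finite_subset[OF B(1) finite_preim])
  obtain z where z: "z ` B \<subseteq> base" "moves z y B r2" using B(4) unfolding sourced_def by blast
  have "moves (\<lambda>_. x i') y B (mass B powr \<alpha> * ?c + r2)" by (rule moves_trans[OF irr[OF finB z(1)] z(2)])
  then have "?di \<le> r1 + (mass B powr \<alpha> * ?c + r2) + \<epsilon>"
    using reassign_not_cheaper[OF opt i B(1) _ _ \<epsilon>] B(3) unfolding sourced_singleton by blast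
  then have "mass B powr \<alpha> * (G - ?c) \<le> 2 * \<epsilon>" using B(5) by (simp add: right_diff_distrib)
  moreover have "n j powr \<alpha> * (G - ?c) \<le> mass B powr \<alpha> * (G - ?c)"
  proof (rule mult_right_mono)
    have "j \<in> B" using B(2) j lev(1) by auto
    then show "n j powr \<alpha> \<le> mass B powr \<alpha>" using mass_powr_mono[OF finB, of "{j}"] by simp
  qed (use GW in simp)
  ultimately show False using \<epsilon> unfolding \<epsilon>_def by simp
qed

lemma next_atom:
  assumes C_finite: "(real DIM('a) - 1) * (1 - \<alpha>) < 1"
    and v: "norm v = 1" and opt: "optimal_assignment \<alpha> k l x y n S"
    and i: "i \<in> {1..k}" and j: "j \<in> preim l S i"
    and less: "axis_coord p v (y j) < axis_coord p v (x i)"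
  shows "\<exists>z\<in>Psi l x y S i. axis_coord p v (y j) < axis_coord p v z \<and>
           axis_coord p v z \<le> axis_coord p v (x i) \<and>
           (2 \<le> k \<longrightarrow> axis_coord p v z - axis_coord p v (y j) \<le>
             2 * C_const \<alpha> DIM('a) * R_max p v k l x y S i +
             (MIN i'\<in>{1..k} - {i}. \<bar>axis_coord p v (x i') - axis_coord p v (y j)\<bar>))"
proof -
  let ?\<pi> = "axis_coord p v"
  let ?Z = "{z \<in> Psi l x y S i. ?\<pi> (y j) < ?\<pi> z}"
  have Z: "finite ?Z" "x i \<in> ?Z" using less by (auto simp: Psi_def)
  define z where "z = arg_min_on ?\<pi> ?Z"
  have z: "z \<in> Psi l x y S i" "?\<pi> (y j) < ?\<pi> z"
    using arg_min_if_finite(1)[of ?Z ?\<pi>] Z unfolding z_def by blast+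
  have least: "?\<pi> z \<le> ?\<pi> w" if "w \<in> ?Z" for w
    using arg_min_least[of ?Z w ?\<pi>] Z that unfolding z_def by blast
  have "?\<pi> z - ?\<pi> (y j) \<le> 2 * C_const \<alpha> DIM('a) * R_max p v k l x y S i +
             (MIN i'\<in>{1..k} - {i}. \<bar>?\<pi> (x i') - ?\<pi> (y j)\<bar>)" if k: "2 \<le> k"
  proof -
    let ?f = "\<lambda>i'. \<bar>?\<pi> (x i') - ?\<pi> (y j)\<bar>"
    have "{1..k} - {i} \<noteq> {}"
    proof
      assume "{1..k} - {i} = {}"
      moreover have "1 \<in> {1..k}" "2 \<in> {1..k}" using k by auto
      ultimately have "1 = i" "2 = i" by blast+
      then show False by simp
    qed
    then have "Min (?f ` ({1..k} - {i})) \<in> ?f ` ({1..k} - {i})" by (intro Min_in) auto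
    then obtain i' where i': "i' \<in> {1..k} - {i}" "Min (?f ` ({1..k} - {i})) = ?f i'" by blast
    have "?\<pi> z - ?\<pi> (y j) \<le> 2 * C_const \<alpha> DIM('a) * R_max p v k l x y S i + ?f i'"
    proof (rule optimal_gap_le[OF C_finite v opt i _ _ j refl z(2) least[OF Z(2)]])
      fix h assume "h \<in> preim l S i"
      then have "y h \<in> Psi l x y S i" by (simp add: Psi_def)
      then show "?\<pi> (y h) \<le> ?\<pi> (y j) \<or> ?\<pi> z \<le> ?\<pi> (y h)" using least[of "y h"] by force
    qed (use i' in auto)
    then show ?thesis using i'(2) by simp
  qed
  then show ?thesis using z least[OF Z(2)] by blast
qed

end

lemma axis_coord_uminus: "axis_coord p (- v) z = - axis_coord p v z"
  by (simp add: axis_coord_def)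

lemma R_max_uminus: "R_max p (- v) k l x y S i = R_max p v k l x y S i"
  by (simp add: R_max_def axis_coord_uminus)

theorem theorem4:
  fixes \<alpha> :: real
    and X :: "(real ^ 'm) set"
    and x y :: "nat \<Rightarrow> real ^ 'm"
    and n :: "nat \<Rightarrow> real"
    and k l :: nat
    and p v :: "real ^ 'm"
    and S :: "nat \<Rightarrow> nat"
    and i j :: nat
  assumes alpha: "0 \<le> \<alpha>" "\<alpha> < 1"
    and C_finite: "(real CARD('m) - 1) * (1 - \<alpha>) < 1"
    and X: "compact X" "convex X"
    and x: "x ` {1..k} \<subseteq> X" "inj_on x {1..k}"
    and y: "y ` {1..l} \<subseteq> X"
    and n: "\<And>h. h \<in> {1..l} \<Longrightarrow> 0 < n h" "(\<Sum>h=1..l. n h) = 1"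
    and v: "norm v = 1"
    and opt: "optimal_assignment \<alpha> k l x y n S"
    and i: "i \<in> {1..k}"
    and j: "j \<in> {1..l}" "S j = i"
    and nondegenerate: "axis_coord p v (y j) \<noteq> axis_coord p v (x i)"
  shows "\<exists>z \<in> Psi l x y S i - {y j}.
           0 < \<bar>axis_coord p v (y j) - axis_coord p v z\<bar> \<and>
           (2 \<le> k \<longrightarrow>
             \<bar>axis_coord p v (y j) - axis_coord p v z\<bar> \<le>
               2 * C_const \<alpha> CARD('m) * R_max p v k l x y S i +
               (MIN i'\<in>{1..k} - {i}. \<bar>axis_coord p v (x i') - axis_coord p v (y j)\<bar>)) \<and>
           axis_coord p v z \<in> closed_segment (axis_coord p v (y j)) (axis_coord p v (x i))"
proof -
  define n' where "n' = (\<lambda>h. if h \<in> {1..l} then n h else 1)"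
  interpret irrigation \<alpha> n' y by unfold_locales (use alpha n(1) in \<open>auto simp: n'_def\<close>)
  have n': "n' h = n h" if "h \<in> preim l T m" for h T m using that by (simp add: n'_def preim_def)
  have "E_alpha \<alpha> k l x y n' T = E_alpha \<alpha> k l x y n T" for T
    unfolding E_alpha_def a_part_def b_part_def by (simp add: n' cong: sum.cong)
  then have "E_alpha \<alpha> k l x y n' = E_alpha \<alpha> k l x y n" by (rule ext)
  then have opt': "optimal_assignment \<alpha> k l x y n' S" using opt by (simp add: optimal_assignment_def)
  have jp: "j \<in> preim l S i" using j by (simp add: preim_def)
  have dim: "(real DIM(real ^ 'm) - 1) * (1 - \<alpha>) < 1" using C_finite by simp
  show ?thesis
  proof (cases "axis_coord p v (y j) < axis_coord p v (x i)")
    case True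
    obtain z where z: "z \<in> Psi l x y S i" "axis_coord p v (y j) < axis_coord p v z"
      "axis_coord p v z \<le> axis_coord p v (x i)"
      "2 \<le> k \<Longrightarrow> axis_coord p v z - axis_coord p v (y j) \<le>
          2 * C_const \<alpha> CARD('m) * R_max p v k l x y S i +
          (MIN i'\<in>{1..k} - {i}. \<bar>axis_coord p v (x i') - axis_coord p v (y j)\<bar>)"
      using next_atom[OF dim v opt' i jp True] by auto
    then show ?thesis
      by (intro bexI[of _ z]) (auto simp: closed_segment_eq_real_ivl)
  next
    case False
    then have less: "axis_coord p (- v) (y j) < axis_coord p (- v) (x i)"
      using nondegenerate by (simp add: axis_coord_uminus)
    have v': "norm (- v) = 1" using v by simp
    have flip: "\<bar>- a - - b\<bar> = \<bar>a - b\<bar>" for a b :: real by simp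
    obtain z where z: "z \<in> Psi l x y S i" "axis_coord p v z < axis_coord p v (y j)"
      "axis_coord p v (x i) \<le> axis_coord p v z"
      "2 \<le> k \<Longrightarrow> axis_coord p v (y j) - axis_coord p v z \<le>
          2 * C_const \<alpha> CARD('m) * R_max p v k l x y S i +
          (MIN i'\<in>{1..k} - {i}. \<bar>axis_coord p v (x i') - axis_coord p v (y j)\<bar>)"
      using next_atom[OF dim v' opt' i jp less] unfolding axis_coord_uminus R_max_uminus flip by auto
    then show ?thesis
      by (intro bexI[of _ z]) (auto simp: closed_segment_eq_real_ivl)
  qed
qed

end
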